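(* Let $k$ be an infinite field and let $R=k[x,y;u,v]$ be bigraded by $\deg x=\deg y=(1,0)$, $\deg u=\deg v=(0,1)$. Let $\phi:\mathbb{P}^1\times\mathbb{P}^1\dashrightarrow\mathbb{P}^2$ be a dominant rational map given by bihomogeneous polynomials $f_0,f_1,f_2\in R$ of bidegree $(1,1)$ without common factor in $R\setminus k$. The following are equivalent: (i) $\phi$ is birational; (ii) the polynomials $f_0,f_1,f_2$ have a nonzero bidegree $(1,0)$ syzygy; (iii) the polynomials $f_0,f_1,f_2$ have a nonzero bidegree $(0,1)$ syzygy.
   Context: A bidegree $(p,q)$ syzygy of $f_0,f_1,f_2$ is a triple $(g_0,g_1,g_2)$ of bihomogeneous polynomials of $R$ of bidegree $(p,q)$ such that $g_0f_0+g_1f_1+g_2f_2=0$. The map $\phi$ sends $((\alpha:\beta),(\gamma:\delta))$ to $(f_0:f_1:f_2)$ evaluated at $(x,y,u,v)=(\alpha,\beta,\gamma,\delta)$. *)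

theory Defs
  imports Complex_Main "HOL-Library.Poly_Mapping" "HOL-Library.Numeral_Type"
begin

section \<open>Polynomials\<close>

type_synonym ('v, 'k) mpoly = "('v \<Rightarrow>\<^sub>0 nat) \<Rightarrow>\<^sub>0 'k"

text \<open>
  The bigraded ring \<open>k[x,y;u,v]\<close> is \<open>(2 + 2, 'k) mpoly\<close>, the variables \<open>x, y\<close> being \<open>Inl 0, Inl 1\<close>
  and \<open>u, v\<close> being \<open>Inr 0, Inr 1\<close>; here \<open>2\<close> is the two-element numeral type.  Likewise
  \<open>(3, 'k) mpoly\<close> is the coordinate ring of the projective plane.
\<close>

definition mpoly_eval :: "('v \<Rightarrow> 'k::comm_semiring_1) \<Rightarrow> ('v, 'k) mpoly \<Rightarrow> 'k" where
  "mpoly_eval a p =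
     (\<Sum>m\<in>Poly_Mapping.keys p. Poly_Mapping.lookup p m *
        (\<Prod>v\<in>Poly_Mapping.keys m. a v ^ Poly_Mapping.lookup m v))"

definition homogeneous :: "nat \<Rightarrow> ('v::finite, 'k::zero) mpoly \<Rightarrow> bool" where
  "homogeneous d p \<longleftrightarrow>
     (\<forall>m\<in>Poly_Mapping.keys p. (\<Sum>v\<in>UNIV. Poly_Mapping.lookup m v) = d)"

definition bihomogeneous ::
  "nat \<Rightarrow> nat \<Rightarrow> ('i::finite + 'j::finite, 'k::zero) mpoly \<Rightarrow> bool" where
  "bihomogeneous p q h \<longleftrightarrow>
     (\<forall>m\<in>Poly_Mapping.keys h.
        (\<Sum>i\<in>UNIV. Poly_Mapping.lookup m (Inl i)) = p \<and>
        (\<Sum>j\<in>UNIV. Poly_Mapping.lookup m (Inr j)) = q)"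

definition mpoly_constants :: "('v, 'k::zero) mpoly set" where
  "mpoly_constants = range (Poly_Mapping.single 0)"

definition no_common_factor :: "('n \<Rightarrow> ('v, 'k::field) mpoly) \<Rightarrow> bool" where
  "no_common_factor f \<longleftrightarrow> (\<forall>d. (\<forall>i. d dvd f i) \<longrightarrow> d \<in> mpoly_constants)"

definition syzygy ::
  "nat \<Rightarrow> nat \<Rightarrow> ('n::finite \<Rightarrow> ('i::finite + 'j::finite, 'k::field) mpoly) \<Rightarrow>
   ('n \<Rightarrow> ('i + 'j, 'k) mpoly) \<Rightarrow> bool" where
  "syzygy p q f g \<longleftrightarrow> (\<forall>i. bihomogeneous p q (g i)) \<and> (\<Sum>i\<in>UNIV. g i * f i) = 0"


section \<open>Projective spaces and their Zariski topology\<close>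

definition proj_rel :: "('i \<Rightarrow> 'k::field) \<Rightarrow> ('i \<Rightarrow> 'k) \<Rightarrow> bool" where
  "proj_rel a b \<longleftrightarrow>
     a \<noteq> (\<lambda>_. 0) \<and> b \<noteq> (\<lambda>_. 0) \<and> (\<exists>c. c \<noteq> 0 \<and> b = (\<lambda>i. c * a i))"

lemma part_equivp_proj_rel: "part_equivp (proj_rel :: ('i \<Rightarrow> 'k::field) \<Rightarrow> _)"
proof (rule part_equivpI)
  show "\<exists>a :: 'i \<Rightarrow> 'k. proj_rel a a"
    by (rule exI[of _ "\<lambda>_. 1"]) (auto simp: proj_rel_def fun_eq_iff intro!: exI[of _ 1])
  show "symp (proj_rel :: ('i \<Rightarrow> 'k) \<Rightarrow> _)"
  proof (rule sympI)
    fix a b :: "'i \<Rightarrow> 'k"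
    assume "proj_rel a b"
    then obtain c where "a \<noteq> (\<lambda>_. 0)" "b \<noteq> (\<lambda>_. 0)" "c \<noteq> 0" "b = (\<lambda>i. c * a i)"
      by (auto simp: proj_rel_def)
    then have "inverse c \<noteq> 0" "a = (\<lambda>i. inverse c * b i)"
      by (auto simp: fun_eq_iff field_simps)
    with \<open>a \<noteq> (\<lambda>_. 0)\<close> \<open>b \<noteq> (\<lambda>_. 0)\<close> show "proj_rel b a"
      unfolding proj_rel_def by blast
  qed
  show "transp (proj_rel :: ('i \<Rightarrow> 'k) \<Rightarrow> _)"
  proof (rule transpI)
    fix a b c :: "'i \<Rightarrow> 'k"
    assume "proj_rel a b" "proj_rel b c"
    then obtain s t where "a \<noteq> (\<lambda>_. 0)" "c \<noteq> (\<lambda>_. 0)" "s \<noteq> 0" "t \<noteq> 0"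
      "b = (\<lambda>i. s * a i)" "c = (\<lambda>i. t * b i)"
      by (auto simp: proj_rel_def)
    then have "t * s \<noteq> 0" "c = (\<lambda>i. (t * s) * a i)"
      by (auto simp: mult.assoc)
    with \<open>a \<noteq> (\<lambda>_. 0)\<close> \<open>c \<noteq> (\<lambda>_. 0)\<close> show "proj_rel a c"
      unfolding proj_rel_def by blast
  qed
qed

text \<open>
  \<open>abs_proj a\<close> is the point with homogeneous coordinates \<open>a\<close>; it is meaningful only for
  \<open>a \<noteq> (\<lambda>_. 0)\<close>.  The projective line and plane are \<open>(2, 'k) proj\<close> and \<open>(3, 'k) proj\<close>.
\<close>

quotient_type (overloaded) ('i, 'k) proj = "'i \<Rightarrow> 'k::field" / partial: proj_rel
  by (rule part_equivp_proj_rel)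

definition proj_closed :: "('i::finite, 'k::field) proj set \<Rightarrow> bool" where
  "proj_closed Z \<longleftrightarrow>
     (\<exists>S. (\<forall>s\<in>S. \<exists>d. homogeneous d s) \<and>
          Z = {abs_proj a | a. a \<noteq> (\<lambda>_. 0) \<and> (\<forall>s\<in>S. mpoly_eval a s = 0)})"

definition biproj_closed ::
  "(('i::finite, 'k::field) proj \<times> ('j::finite, 'k) proj) set \<Rightarrow> bool" where
  "biproj_closed Z \<longleftrightarrow>
     (\<exists>S. (\<forall>s\<in>S. \<exists>p q. bihomogeneous p q s) \<and>
          Z = {(abs_proj a, abs_proj b) | a b.
                 a \<noteq> (\<lambda>_. 0) \<and> b \<noteq> (\<lambda>_. 0) \<and> (\<forall>s\<in>S. mpoly_eval (case_sum a b) s = 0)})"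


section \<open>Rational maps\<close>

text \<open>
  A rational map is given by a tuple of forms, and represented by the graph of the partial
  function which is defined where the forms do not vanish simultaneously.
\<close>

definition biproj_map ::
  "('n \<Rightarrow> ('i::finite + 'j::finite, 'k::field) mpoly) \<Rightarrow>
   ((('i, 'k) proj \<times> ('j, 'k) proj) \<times> ('n, 'k) proj) set" where
  "biproj_map f =
     {((abs_proj a, abs_proj b), abs_proj (\<lambda>n. mpoly_eval (case_sum a b) (f n))) | a b.
        a \<noteq> (\<lambda>_. 0) \<and> b \<noteq> (\<lambda>_. 0) \<and> (\<lambda>n. mpoly_eval (case_sum a b) (f n)) \<noteq> (\<lambda>_. 0)}"

text \<open>A rational map to a product of projective spaces is a pair of rational maps.\<close>

definition proj_bimap ::
  "('i \<Rightarrow> ('n::finite, 'k::field) mpoly) \<Rightarrow> ('j \<Rightarrow> ('n, 'k) mpoly) \<Rightarrow>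
   (('n, 'k) proj \<times> (('i, 'k) proj \<times> ('j, 'k) proj)) set" where
  "proj_bimap A B =
     {(abs_proj c, (abs_proj (\<lambda>i. mpoly_eval c (A i)), abs_proj (\<lambda>j. mpoly_eval c (B j)))) | c.
        c \<noteq> (\<lambda>_. 0) \<and> (\<lambda>i. mpoly_eval c (A i)) \<noteq> (\<lambda>_. 0) \<and> (\<lambda>j. mpoly_eval c (B j)) \<noteq> (\<lambda>_. 0)}"

definition dominant ::
  "('n::finite \<Rightarrow> ('i::finite + 'j::finite, 'k::field) mpoly) \<Rightarrow> bool" where
  "dominant f \<longleftrightarrow> (\<forall>Z. proj_closed Z \<and> Range (biproj_map f) \<subseteq> Z \<longrightarrow> Z = UNIV)"

text \<open>
  The map is birational if it has an inverse rational map: both composites agree with the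
  identity on a nonempty Zariski open set.  Over an infinite field nonempty open sets of
  rational points of these varieties are dense, so that this is equality of rational maps.
\<close>

definition birational ::
  "('n::finite \<Rightarrow> ('i::finite + 'j::finite, 'k::field) mpoly) \<Rightarrow> bool" where
  "birational f \<longleftrightarrow>
     (\<exists>A B d e.
        (\<forall>i. homogeneous d (A i)) \<and> (\<exists>i. A i \<noteq> 0) \<and>
        (\<forall>j. homogeneous e (B j)) \<and> (\<exists>j. B j \<noteq> 0) \<and>
        (\<exists>Z. biproj_closed Z \<and> Z \<noteq> UNIV \<and>
             (\<forall>P. P \<notin> Z \<longrightarrow> (P, P) \<in> biproj_map f O proj_bimap A B)) \<and>
        (\<exists>Z. proj_closed Z \<and> Z \<noteq> UNIV \<and>
             (\<forall>Q. Q \<notin> Z \<longrightarrow> (Q, Q) \<in> proj_bimap A B O biproj_map f)))"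

end

theory Submission
  imports Defs "HOL-Analysis.Cartesian_Space" "HOL-Computational_Algebra.Polynomial"
begin

text \<open>
  Written on coordinates, \<open>f\<close> is a bilinear map from \<open>k\<^sup>2 \<times> k\<^sup>2\<close> to \<open>k\<^sup>3\<close> whose values span \<open>k\<^sup>3\<close> by
  dominance, so it is the projection of the space of \<open>2 \<times> 2\<close> matrices from a single matrix \<open>N\<close>.  All
  three conditions turn out to be equivalent to the existence of a rational base point, that is, to
  \<open>N\<close> having rank one.  If \<open>N = n \<otimes> m\<close>, the forms become \<open>x v\<close>, \<open>y u\<close>, \<open>y v\<close> in suitable
  coordinates, which have an evident inverse and the evident linear syzygies \<open>y (x v) = x (y v)\<close> and
  \<open>v (y u) = u (y v)\<close>.  If \<open>N\<close> is invertible, the forms become \<open>x u\<close>, \<open>y v\<close>, \<open>x v + y u\<close>: they have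
  no linear syzygy, and are invariant under exchanging the two factors, so that over an infinite
  field no nonempty open set is mapped injectively.
\<close>

section \<open>Bilinear maps to a three-dimensional space\<close>

lemma UNIV_bit: "(UNIV :: 2 set) = {0, 1}"
proof -
  \<comment> \<open>The numeral type computes modulo 2, so the element that \<open>UNIV_2\<close>
    lists as \<open>2\<close> is the one written \<open>0\<close> here.\<close>
  have "(2 :: 2) = 0"
    by simp
  then show ?thesis
    using UNIV_2 by auto
qed

lemma sum_bit: "sum h (UNIV :: 2 set) = h 0 + h 1"
  by (simp add: UNIV_bit)

lemma bit_cases: "(x :: 2) = 0 \<or> x = 1"
proof -
  have "x \<in> {0, 1}"
    unfolding UNIV_bit[symmetric] by (rule UNIV_I)
  then show ?thesis
    by simp
qed

lemma all_bit: "(\<forall>x :: 2. P x) \<longleftrightarrow> P 0 \<and> P 1"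
proof -
  have "(\<forall>x\<in>UNIV :: 2 set. P x) \<longleftrightarrow> P 0 \<and> P 1"
    unfolding UNIV_bit by simp
  then show ?thesis
    by simp
qed

section \<open>Bilinear maps, syzygies and base points in coordinates\<close>

definition dot :: "('i::finite \<Rightarrow> 'k::field) \<Rightarrow> ('i \<Rightarrow> 'k) \<Rightarrow> 'k" where
  "dot c d = (\<Sum>i\<in>UNIV. c i * d i)"

text \<open>\<open>M i p q\<close> stands for the coefficient of the \<open>p\<close>-th variable of
  the first pair times the \<open>q\<close>-th variable of the second pair in the
  \<open>i\<close>-th form. The result is thus the vector of values of the forms at
  \<open>(a, b)\<close>.\<close>

definition bil :: "('n \<Rightarrow> 2 \<Rightarrow> 2 \<Rightarrow> 'k::field) \<Rightarrow> (2 \<Rightarrow> 'k) \<Rightarrow> (2 \<Rightarrow> 'k) \<Rightarrow> 'n \<Rightarrow> 'k" where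
  "bil M a b i = (\<Sum>p\<in>UNIV. \<Sum>q\<in>UNIV. M i p q * a p * b q)"

text \<open>For fixed nonzero \<open>a\<close> this is the linear form in \<open>b\<close> that cuts
  out the line spanned by \<open>a\<close>; such forms serve as coordinates on each factor.\<close>

definition det2 :: "(2 \<Rightarrow> 'k::field) \<Rightarrow> (2 \<Rightarrow> 'k) \<Rightarrow> 'k" where
  "det2 a b = a 0 * b 1 - a 1 * b 0"

text \<open>Linear independence of the component forms, phrased geometrically: no hyperplane
  contains all values of the map.\<close>

definition nondegenerate :: "('n::finite \<Rightarrow> 2 \<Rightarrow> 2 \<Rightarrow> 'k::field) \<Rightarrow> bool" where
  "nondegenerate M \<longleftrightarrow> (\<forall>c. (\<forall>a b. dot c (bil M a b) = 0) \<longrightarrow> c = (\<lambda>_. 0))"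

definition has_base_point :: "('n \<Rightarrow> 2 \<Rightarrow> 2 \<Rightarrow> 'k::field) \<Rightarrow> bool" where
  "has_base_point M \<longleftrightarrow>
     (\<exists>n m. n \<noteq> (\<lambda>_. 0) \<and> m \<noteq> (\<lambda>_. 0) \<and> bil M n m = (\<lambda>_. 0))"

text \<open>\<open>G i r\<close> is the coefficient of the \<open>r\<close>-th variable in the
  \<open>i\<close>-th entry of a syzygy of bidegree (1,0). Imposing the relation on values keeps the
  analysis within linear algebra.\<close>

definition linear_syzygy ::
  "('n::finite \<Rightarrow> 2 \<Rightarrow> 2 \<Rightarrow> 'k::field) \<Rightarrow> ('n \<Rightarrow> 2 \<Rightarrow> 'k) \<Rightarrow> bool" where
  "linear_syzygy M G \<longleftrightarrow> (\<forall>a b. dot (\<lambda>i. dot (G i) a) (bil M a b) = 0)"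

text \<open>Exchanging the two factors turns syzygies of bidegree (0,1) into syzygies of bidegree
  (1,0), so that only one kind has to be analysed.\<close>

lemma bil_swap: "bil (\<lambda>i p q. M i q p) b a = bil M a b"
  by (rule ext) (simp add: bil_def sum_bit algebra_simps)

lemma nondegenerate_swap: "nondegenerate (\<lambda>i p q. M i q p) \<longleftrightarrow> nondegenerate M"
  by (auto simp: nondegenerate_def bil_swap[of M])

lemma has_base_point_swap: "has_base_point (\<lambda>i p q. M i q p) \<longleftrightarrow> has_base_point M"
  by (auto simp: has_base_point_def bil_swap[of M])

lemma bil_combination:
  "bil M (\<lambda>p. s * n p + t * n' p) (\<lambda>q. s' * m q + t' * m' q) i =
     s * s' * bil M n m i + s * t' * bil M n m' i + t * s' * bil M n' m i + t * t' * bil M n' m' i"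
  by (simp add: bil_def sum_bit algebra_simps)

lemma dot_zero: "dot c (\<lambda>_. 0) = 0" "dot (\<lambda>_. 0) c = 0"
  by (simp_all add: dot_def)

lemma dot_combination:
  "dot c (\<lambda>i. x * u i + y * v i + z * w i) = x * dot c u + y * dot c v + z * dot c w"
  by (simp add: dot_def sum.distrib sum_distrib_left algebra_simps)

lemma dot_indicator: "dot c (\<lambda>i. of_bool (i = j)) = c j"
  by (simp add: dot_def)

section \<open>Bases, dual bases and linear relations\<close>

text \<open>The square matrix with columns \<open>w j\<close> either has a nonzero kernel vector,
  which is the relation, or a left inverse. The rows \<open>D j\<close> of the left inverse are the
  dual basis, and since it is also a right inverse, every vector expands in the
  \<open>w j\<close>.\<close>

lemma basis_or_relation:
  fixes w :: "'n::finite \<Rightarrow> 'n \<Rightarrow> 'k::field"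
  obtains (relation) x where "x \<noteq> (\<lambda>_. 0)" "\<And>i. (\<Sum>j\<in>UNIV. x j * w j i) = 0"
  | (basis) D where "\<And>j l. dot (D j) (w l) = of_bool (j = l)"
      "\<And>i l. (\<Sum>j\<in>UNIV. D j l * w j i) = of_bool (i = l)"
proof (cases "\<exists>x :: 'k ^ 'n. x \<noteq> 0 \<and> (\<chi> i j. w j i) *v x = 0")
  case True
  then obtain x :: "'k ^ 'n" where x: "x \<noteq> 0" "(\<chi> i j. w j i) *v x = 0"
    by blast
  have "(\<Sum>j\<in>UNIV. x $ j * w j i) = 0" for i
  proof -
    have "((\<chi> i j. w j i) *v x) $ i = 0"
      using x(2) by simp
    then show ?thesis
      by (simp add: matrix_vector_mult_def mult.commute)
  qed
  moreover have "(\<lambda>j. x $ j) \<noteq> (\<lambda>_. 0)"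
    using x(1) by (auto simp: vec_eq_iff fun_eq_iff)
  ultimately show ?thesis
    by (rule relation[rotated])
next
  case False
  then obtain B :: "'k ^ 'n ^ 'n" where B: "B ** (\<chi> i j. w j i) = mat 1"
    using matrix_left_invertible_ker by blast
  then have B': "(\<chi> i j. w j i) ** B = mat 1"
    using matrix_left_right_inverse by blast
  have "dot (\<lambda>i. B $ j $ i) (w l) = of_bool (j = l)" for j l
    using arg_cong[OF B, of "\<lambda>A. A $ j $ l"]
    by (simp add: matrix_matrix_mult_def mat_def dot_def split: if_splits)
  moreover have "(\<Sum>j\<in>UNIV. B $ j $ l * w j i) = of_bool (i = l)" for i l
    using arg_cong[OF B', of "\<lambda>A. A $ i $ l"]
    by (simp add: matrix_matrix_mult_def mat_def mult.commute split: if_splits)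
  ultimately show ?thesis
    by (rule basis)
qed

definition triple :: "'a \<Rightarrow> 'a \<Rightarrow> 'a \<Rightarrow> 3 \<Rightarrow> 'a" where
  "triple x y z j = (if j = 1 then x else if j = 2 then y else z)"

lemma triple_simps: "triple x y z 1 = x" "triple x y z 2 = y" "triple x y z 3 = z"
  by (simp_all add: triple_def)

lemma basis_or_relation3:
  fixes X Y Z :: "3 \<Rightarrow> 'k::field"
  obtains (relation) x y z where "x \<noteq> 0 \<or> y \<noteq> 0 \<or> z \<noteq> 0" "\<And>i. x * X i + y * Y i + z * Z i = 0"
  | (basis) \<alpha> \<beta> \<gamma> where
      "dot \<alpha> X = 1" "dot \<alpha> Y = 0" "dot \<alpha> Z = 0"
      "dot \<beta> X = 0" "dot \<beta> Y = 1" "dot \<beta> Z = 0"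
      "dot \<gamma> X = 0" "dot \<gamma> Y = 0" "dot \<gamma> Z = 1"
      "\<forall>c i. c i = dot \<alpha> c * X i + dot \<beta> c * Y i + dot \<gamma> c * Z i"
proof (cases rule: basis_or_relation[of "triple X Y Z"])
  case (relation x)
  have "x 1 \<noteq> 0 \<or> x 2 \<noteq> 0 \<or> x 3 \<noteq> 0"
  proof (rule ccontr)
    assume "\<not> ?thesis"
    then have "x j = 0" for j
      using exhaust_3[of j] by auto
    with relation(1) show False
      by (simp add: fun_eq_iff)
  qed
  moreover have "x 1 * X i + x 2 * Y i + x 3 * Z i = 0" for i
    using relation(2)[of i] by (simp add: sum_3 triple_simps)
  ultimately show ?thesis
    using that(1) by blast
next
  case (basis D)
  have expand: "\<forall>c i. c i = dot (D 1) c * X i + dot (D 2) c * Y i + dot (D 3) c * Z i"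
  proof (intro allI)
    fix c :: "3 \<Rightarrow> 'k" and i :: 3
    have "c i = (\<Sum>l\<in>UNIV. c l * of_bool (i = l))"
      by (simp add: eq_commute[of i])
    also have "\<dots> = (\<Sum>l\<in>UNIV. c l * (\<Sum>j\<in>UNIV. D j l * triple X Y Z j i))"
      by (simp only: basis(2))
    finally show "c i = dot (D 1) c * X i + dot (D 2) c * Y i + dot (D 3) c * Z i"
      by (simp add: dot_def sum_3 triple_simps algebra_simps)
  qed
  show ?thesis
    by (rule that(2)[OF _ _ _ _ _ _ _ _ _ expand])
      (use basis(1)[of _ 1] basis(1)[of _ 2] basis(1)[of _ 3] in \<open>simp_all add: triple_simps\<close>)
qed

text \<open>Spanning is turned into independence by using the dichotomy twice. For the transposed
  family a relation would be a nonzero functional killing \<open>X\<close>, \<open>Y\<close>,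
  \<open>Z\<close>, so there is a family dual to them; pairing a relation between \<open>X\<close>,
  \<open>Y\<close>, \<open>Z\<close> with it makes all coefficients vanish.\<close>

lemma basis3:
  fixes X Y Z :: "3 \<Rightarrow> 'k::field"
  assumes "\<And>c. dot c X = 0 \<Longrightarrow> dot c Y = 0 \<Longrightarrow> dot c Z = 0 \<Longrightarrow> c = (\<lambda>_. 0)"
  obtains \<alpha> \<beta> \<gamma> where
    "dot \<alpha> X = 1" "dot \<alpha> Y = 0" "dot \<alpha> Z = 0"
    "dot \<beta> X = 0" "dot \<beta> Y = 1" "dot \<beta> Z = 0"
    "dot \<gamma> X = 0" "dot \<gamma> Y = 0" "dot \<gamma> Z = 1"
    "\<forall>c i. c i = dot \<alpha> c * X i + dot \<beta> c * Y i + dot \<gamma> c * Z i"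
proof (cases rule: basis_or_relation[of "\<lambda>i j. triple X Y Z j i"])
  case (relation c)
  have "c = (\<lambda>_. 0)"
    using relation(2)[of 1] relation(2)[of 2] relation(2)[of 3] by (intro assms) (simp_all add: dot_def triple_simps)
  with relation(1) show ?thesis
    by simp
next
  case (basis D)
  show ?thesis
  proof (cases rule: basis_or_relation3[of X Y Z])
    case (relation x y z)
    have lin: "(\<Sum>i\<in>UNIV. D i l * (x * X i + y * Y i + z * Z i)) =
        x * (\<Sum>i\<in>UNIV. D i l * X i) + y * (\<Sum>i\<in>UNIV. D i l * Y i) + z * (\<Sum>i\<in>UNIV. D i l * Z i)"
      for l
      by (simp add: sum.distrib sum_distrib_left algebra_simps)
    have "x * of_bool (l = 1) + y * of_bool (l = 2) + z * of_bool (l = 3) = 0" for l :: 3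
      using basis(2)[of l 1] basis(2)[of l 2] basis(2)[of l 3] relation(2) lin[of l]
      by (simp add: triple_simps)
    from this[of 1] this[of 2] this[of 3] relation(1) show ?thesis
      by simp
  next
    case (basis \<alpha> \<beta> \<gamma>)
    then show ?thesis
      by (rule that)
  qed
qed

section \<open>The normal form at a base point\<close>

lemma det2_complement:
  assumes "n \<noteq> (\<lambda>_. 0)"
  obtains n' where "det2 n n' = 1"
proof (cases "n 0 = 0")
  case True
  then have "n 1 \<noteq> 0"
    using assms by (auto simp: fun_eq_iff all_bit)
  then have "det2 n (\<lambda>p. if p = 0 then - 1 / n 1 else 0) = 1"
    using True by (simp add: det2_def)
  then show ?thesis ..
next
  case False
  then have "det2 n (\<lambda>p. if p = 0 then 0 else 1 / n 0) = 1"
    by (simp add: det2_def)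
  then show ?thesis ..
qed

lemma det2_self: "det2 a a = 0"
  by (simp add: det2_def)

text \<open>Cramer's rule for a basis of determinant one: the coordinates of \<open>a\<close> are
  \<open>det2 a n'\<close> and \<open>det2 n a\<close>.\<close>

lemma det2_expand:
  assumes "det2 n n' = 1"
  shows "det2 a n' * n p + det2 n a * n' p = a p"
proof -
  have "det2 a n' * n p + det2 n a * n' p = det2 n n' * a p"
    using bit_cases[of p] by (auto simp: det2_def algebra_simps)
  then show ?thesis
    using assms by simp
qed

lemma det2_expand_fun:
  assumes "det2 n n' = 1"
  shows "(\<lambda>p. det2 a n' * n p + det2 n a * n' p) = a"
  using det2_expand[OF assms] by blast

text \<open>
  The inverse of the map is \<open>c \<mapsto> (\<alpha>(c) n + \<gamma>(c) n', \<beta>(c) m + \<gamma>(c) m')\<close>: this is the passage to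
  the coordinates in which the three forms are \<open>x v\<close>, \<open>y u\<close> and \<open>y v\<close>.
\<close>

lemma base_point_normal_form:
  fixes M :: "3 \<Rightarrow> 2 \<Rightarrow> 2 \<Rightarrow> 'k::field"
  assumes "nondegenerate M" "has_base_point M"
  obtains n n' m m' \<alpha> \<beta> \<gamma> where "det2 n n' = 1" "det2 m m' = 1"
    "\<And>a b. dot \<alpha> (bil M a b) = det2 a n' * det2 m b"
    "\<And>a b. dot \<beta> (bil M a b) = det2 n a * det2 b m'"
    "\<And>a b. dot \<gamma> (bil M a b) = det2 n a * det2 m b"
    "\<And>c. bil M (\<lambda>p. dot \<alpha> c * n p + dot \<gamma> c * n' p) (\<lambda>q. dot \<beta> c * m q + dot \<gamma> c * m' q) =
       (\<lambda>i. dot \<gamma> c * c i)"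
proof -
  from assms(2) obtain n m where nm: "n \<noteq> (\<lambda>_. 0)" "m \<noteq> (\<lambda>_. 0)" "bil M n m = (\<lambda>_. 0)"
    unfolding has_base_point_def by blast
  obtain n' where n': "det2 n n' = 1"
    using nm(1) by (rule det2_complement)
  obtain m' where m': "det2 m m' = 1"
    using nm(2) by (rule det2_complement)
  \<comment> \<open>Of the four products of basis vectors the base point kills
    \<open>bil M n m\<close>. All values are therefore combinations of the other three, which must
    form a basis by nondegeneracy.\<close>
  have comb: "bil M (\<lambda>p. s * n p + t * n' p) (\<lambda>q. s' * m q + t' * m' q) =
      (\<lambda>i. s * t' * bil M n m' i + t * s' * bil M n' m i + t * t' * bil M n' m' i)"
    for s t s' t'
    using nm(3) by (simp add: fun_eq_iff bil_combination)
  have expand: "bil M a b = (\<lambda>i. det2 a n' * det2 m b * bil M n m' i +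
      det2 n a * det2 b m' * bil M n' m i + det2 n a * det2 m b * bil M n' m' i)" for a b
    using comb[of "det2 a n'" "det2 n a" "det2 b m'" "det2 m b"]
    by (simp only: det2_expand_fun[OF n', of a] det2_expand_fun[OF m', of b])
  have span: "c = (\<lambda>_. 0)"
    if "dot c (bil M n m') = 0" "dot c (bil M n' m) = 0" "dot c (bil M n' m') = 0" for c
  proof -
    have "dot c (bil M a b) = 0" for a b
      by (subst expand[of a b]) (simp add: dot_combination that)
    then show ?thesis
      using assms(1) unfolding nondegenerate_def by blast
  qed
  obtain \<alpha> \<beta> \<gamma> where dual:
    "dot \<alpha> (bil M n m') = 1" "dot \<alpha> (bil M n' m) = 0" "dot \<alpha> (bil M n' m') = 0"
    "dot \<beta> (bil M n m') = 0" "dot \<beta> (bil M n' m) = 1" "dot \<beta> (bil M n' m') = 0"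
    "dot \<gamma> (bil M n m') = 0" "dot \<gamma> (bil M n' m) = 0" "dot \<gamma> (bil M n' m') = 1"
    "\<forall>c i. c i = dot \<alpha> c * bil M n m' i + dot \<beta> c * bil M n' m i + dot \<gamma> c * bil M n' m' i"
    by (rule basis3[OF span])
  show ?thesis
  proof (rule that[OF n' m', of \<alpha> \<beta> \<gamma>])
    show "dot \<alpha> (bil M a b) = det2 a n' * det2 m b"
      "dot \<beta> (bil M a b) = det2 n a * det2 b m'"
      "dot \<gamma> (bil M a b) = det2 n a * det2 m b" for a b
      by (subst expand[of a b], simp add: dot_combination dual(1-9))+
    show "bil M (\<lambda>p. dot \<alpha> c * n p + dot \<gamma> c * n' p) (\<lambda>q. dot \<beta> c * m q + dot \<gamma> c * m' q) =
        (\<lambda>i. dot \<gamma> c * c i)" for c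
    proof
      fix i
      \<comment> \<open>The only term of the bilinear expansion without a factor
        \<open>dot \<gamma> c\<close> belongs to the base point. What remains is
        \<open>dot \<gamma> c\<close> times the expansion of \<open>c\<close> in the basis.\<close>
      have "dot \<gamma> c * c i = dot \<gamma> c *
          (dot \<alpha> c * bil M n m' i + dot \<beta> c * bil M n' m i + dot \<gamma> c * bil M n' m' i)"
        using dual(10)[rule_format, of c i] by (rule arg_cong)
      also have "\<dots> = bil M (\<lambda>p. dot \<alpha> c * n p + dot \<gamma> c * n' p)
          (\<lambda>q. dot \<beta> c * m q + dot \<gamma> c * m' q) i"
        by (simp only: comb) (simp add: algebra_simps)
      finally show "bil M (\<lambda>p. dot \<alpha> c * n p + dot \<gamma> c * n' p)
          (\<lambda>q. dot \<beta> c * m q + dot \<gamma> c * m' q) i = dot \<gamma> c * c i" ..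
    qed
  qed
qed

section \<open>The relation matrix and the symmetric case\<close>

text \<open>The four coefficient vectors lie in a space of dimension three. Either three of them are
  already dependent, or the remaining one is a combination of these, where its own coefficient -1
  keeps the relation nontrivial.\<close>

lemma bil_relation:
  fixes M :: "3 \<Rightarrow> 2 \<Rightarrow> 2 \<Rightarrow> 'k::field"
  shows "\<exists>N. N \<noteq> (\<lambda>_ _. 0) \<and> (\<forall>i. (\<Sum>p\<in>UNIV. \<Sum>q\<in>UNIV. N p q * M i p q) = 0)"
proof -
  have witness: ?thesis
    if nz: "x00 \<noteq> 0 \<or> x01 \<noteq> 0 \<or> x10 \<noteq> 0 \<or> x11 \<noteq> 0"
      and rel: "\<And>i. x00 * M i 0 0 + x01 * M i 0 1 + (x10 * M i 1 0 + x11 * M i 1 1) = 0"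
    for x00 x01 x10 x11
  proof -
    define N where "N p q = (if p = 0 then if q = 0 then x00 else x01
      else if q = 0 then x10 else x11)" for p q :: 2
    have "N p q \<noteq> 0" if "N = (\<lambda>_ _. 0)" for p q
      using nz fun_cong[OF fun_cong[OF that], of 0 0] fun_cong[OF fun_cong[OF that], of 0 1]
        fun_cong[OF fun_cong[OF that], of 1 0] fun_cong[OF fun_cong[OF that], of 1 1]
      by (simp add: N_def)
    then have "N \<noteq> (\<lambda>_ _. 0)"
      by auto
    moreover have "(\<Sum>p\<in>UNIV. \<Sum>q\<in>UNIV. N p q * M i p q) = 0" for i
      using rel[of i] by (simp add: N_def sum_bit)
    ultimately show ?thesis
      by blast
  qed
  show ?thesis
  proof (cases rule: basis_or_relation3[of "\<lambda>i. M i 0 1" "\<lambda>i. M i 1 0" "\<lambda>i. M i 1 1"])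
    case (relation x y z)
    then show ?thesis
      by (intro witness[of 0 x y z]) (simp_all add: add.assoc)
  next
    case (basis \<alpha> \<beta> \<gamma>)
    let ?c = "\<lambda>i. M i 0 0"
    have "- 1 * c + u + (v + w) = 0" if "c = u + v + w" for c u v w :: 'k
      using that by simp
    from this[OF basis(10)[rule_format, of ?c]] show ?thesis
      by (intro witness[of "- 1" "dot \<alpha> ?c" "dot \<beta> ?c" "dot \<gamma> ?c"]) simp_all
  qed
qed

text \<open>
  \<open>M\<close> is the projection of the space of \<open>2 \<times> 2\<close> matrices from a point \<open>N\<close>.  If \<open>N\<close> has rank one,
  it is a base point on the Segre quadric.  If \<open>N\<close> is invertible, it serves to identify the
  two factors so that the map becomes symmetric.
\<close>

lemma base_point_or_symmetric:
  fixes M :: "3 \<Rightarrow> 2 \<Rightarrow> 2 \<Rightarrow> 'k::field"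
  obtains "has_base_point M"
  | m m' where "det2 m m' \<noteq> 0"
    "\<And>a b. bil M a (\<lambda>q. b 0 * m q + b 1 * m' q) = bil M b (\<lambda>q. a 0 * m q + a 1 * m' q)"
proof -
  obtain N where N: "N \<noteq> (\<lambda>_ _. 0)" "\<And>i. (\<Sum>p\<in>UNIV. \<Sum>q\<in>UNIV. N p q * M i p q) = 0"
    using bil_relation[of M] by blast
  have rel: "M i 0 0 * N 0 0 = - (M i 0 1 * N 0 1 + M i 1 0 * N 1 0 + M i 1 1 * N 1 1)" for i
    using N(2)[of i] by (simp add: sum_bit algebra_simps eq_neg_iff_add_eq_0)
  show ?thesis
  proof (cases "det2 (N 0) (N 1) = 0")
    case True
    from N(1) obtain p q where pq: "N p q \<noteq> 0"
      by (auto simp: fun_eq_iff)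
    \<comment> \<open>The vanishing determinant means rank one: \<open>N p q\<close> times the
      matrix \<open>N\<close> is the outer product of its column \<open>q\<close> and its row
      \<open>p\<close>. Evaluating the map at that column and row therefore gives a multiple of the
      relation.\<close>
    have minors: "N r q * N p s = N r s * N p q" for r s
      using True bit_cases[of p] bit_cases[of q] bit_cases[of r] bit_cases[of s]
      by (auto simp: det2_def algebra_simps)
    have "bil M (\<lambda>r. N r q) (N p) i = 0" for i
    proof -
      have "bil M (\<lambda>r. N r q) (N p) i = (\<Sum>r\<in>UNIV. \<Sum>s\<in>UNIV. M i r s * (N r s * N p q))"
        by (simp add: bil_def mult.assoc minors)
      also have "\<dots> = (\<Sum>r\<in>UNIV. \<Sum>s\<in>UNIV. N r s * M i r s) * N p q"
        by (simp add: sum_bit algebra_simps)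
      finally show ?thesis
        by (simp add: N(2))
    qed
    moreover have "(\<lambda>r. N r q) \<noteq> (\<lambda>_. 0)" "N p \<noteq> (\<lambda>_. 0)"
      using pq by (auto simp: fun_eq_iff)
    ultimately have "has_base_point M"
      unfolding has_base_point_def by blast
    then show ?thesis
      using that(1) by blast
  next
    case False
    show ?thesis
    \<comment> \<open>The rows of \<open>N\<close> are turned by a quarter turn so that the
      difference of the two sides is alternating in \<open>a\<close> and \<open>b\<close>. It is
      then \<open>det2 a b\<close> times the relation defined by \<open>N\<close>, hence
      zero.\<close>
    proof (rule that(2)[of "\<lambda>q. - N 1 q" "N 0"])
      show "det2 (\<lambda>q. - N 1 q) (N 0) \<noteq> 0"
        using False by (simp add: det2_def algebra_simps)
      show "bil M a (\<lambda>q. b 0 * - N 1 q + b 1 * N 0 q) =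
          bil M b (\<lambda>q. a 0 * - N 1 q + a 1 * N 0 q)" for a b
      proof
        fix i
        have "bil M a (\<lambda>q. b 0 * - N 1 q + b 1 * N 0 q) i -
            bil M b (\<lambda>q. a 0 * - N 1 q + a 1 * N 0 q) i =
            (a 0 * b 1 - a 1 * b 0) * (\<Sum>p\<in>UNIV. \<Sum>q\<in>UNIV. N p q * M i p q)"
          by (simp add: bil_def sum_bit algebra_simps)
        then show "bil M a (\<lambda>q. b 0 * - N 1 q + b 1 * N 0 q) i =
            bil M b (\<lambda>q. a 0 * - N 1 q + a 1 * N 0 q) i"
          by (simp add: N(2))
      qed
    qed
  qed
qed

section \<open>Linear syzygies of a bilinear map\<close>

text \<open>At a base point the normal form supplies the syzygy \<open>y (x v) = x (y v)\<close>. In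
  the symmetric case, comparing coefficients makes both coefficient vectors of a syzygy orthogonal
  to all values, so they vanish by nondegeneracy.\<close>

lemma linear_syzygy_iff_base_point:
  fixes M :: "3 \<Rightarrow> 2 \<Rightarrow> 2 \<Rightarrow> 'k::field"
  assumes "nondegenerate M"
  shows "(\<exists>G. linear_syzygy M G \<and> G \<noteq> (\<lambda>_ _. 0)) \<longleftrightarrow> has_base_point M"
proof
  assume "has_base_point M"
  then obtain n n' m m' \<alpha> \<beta> \<gamma> where nf: "det2 n n' = 1" "det2 m m' = 1"
    "\<And>a b. dot \<alpha> (bil M a b) = det2 a n' * det2 m b"
    "\<And>a b. dot \<gamma> (bil M a b) = det2 n a * det2 m b"
    by (rule base_point_normal_form[OF assms]) (rule that)
  \<comment> \<open>With \<open>x = det2 a n'\<close> and \<open>y = det2 n a\<close> this is the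
    linear form \<open>y \<alpha> - x \<gamma>\<close>, written out in the original coordinates of
    \<open>a\<close>.\<close>
  define G where "G i = (\<lambda>r :: 2. if r = 0 then - n 1 * \<alpha> i - n' 1 * \<gamma> i else n 0 * \<alpha> i + n' 0 * \<gamma> i)" for i
  have G: "dot (G i) a = det2 n a * \<alpha> i - det2 a n' * \<gamma> i" for i a
    by (simp add: G_def dot_def sum_bit det2_def algebra_simps)
  have "dot (\<lambda>i. dot (G i) a) (bil M a b) = 0" for a b
  proof -
    have "dot (\<lambda>i. dot (G i) a) (bil M a b) =
        det2 n a * dot \<alpha> (bil M a b) - det2 a n' * dot \<gamma> (bil M a b)"
      unfolding G by (simp add: dot_def sum_subtractf sum_distrib_left algebra_simps)
    then show ?thesis
      by (simp add: nf algebra_simps)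
  qed
  moreover have "G \<noteq> (\<lambda>_ _. 0)"
  proof
    assume "G = (\<lambda>_ _. 0)"
    \<comment> \<open>At \<open>a = n'\<close> the coordinates are \<open>x = 0\<close> and
      \<open>y = 1\<close>, so \<open>G\<close> takes the value \<open>\<alpha>\<close> there. But
      \<open>\<alpha>\<close> is nonzero, having value 1 on \<open>bil M n m'\<close>.\<close>
    then have "\<alpha> i = 0" for i
      using G[of i n'] nf(1) by (simp add: det2_self dot_zero)
    then have "\<alpha> = (\<lambda>_. 0)"
      by blast
    then show False
      using nf(1,2) nf(3)[of n m'] by (simp add: dot_zero)
  qed
  ultimately show "\<exists>G. linear_syzygy M G \<and> G \<noteq> (\<lambda>_ _. 0)"
    unfolding linear_syzygy_def by blast
next
  assume "\<exists>G. linear_syzygy M G \<and> G \<noteq> (\<lambda>_ _. 0)"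
  then obtain G where G: "linear_syzygy M G" "G \<noteq> (\<lambda>_ _. 0)"
    by blast
  show "has_base_point M"
  proof (cases rule: base_point_or_symmetric[of M])
    case (2 m m')
    define e where "e p = (\<lambda>r :: 2. of_bool (r = p) :: 'k)" for p
    define g where "g p = (\<lambda>i. G i p)" for p
    have T: "dot (\<lambda>i. a 0 * g 0 i + a 1 * g 1 i) (bil M a b) = 0" for a b
      using G(1) by (simp add: linear_syzygy_def g_def dot_def sum_bit mult.commute)
    have expand: "dot (\<lambda>i. x * g 0 i + y * g 1 i) d = x * dot (g 0) d + y * dot (g 1) d" for x y d
      by (simp add: dot_def sum.distrib sum_distrib_left algebra_simps)
    have e: "a = (\<lambda>p. a 0 * e 0 p + a 1 * e 1 p)" for a
    proof
      fix p
      show "a p = a 0 * e 0 p + a 1 * e 1 p"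
        using bit_cases[of p] by (auto simp: e_def)
    qed
    \<comment> \<open>\<open>T0\<close>, \<open>T1\<close> and \<open>T01\<close> are the
      coefficients of the two squares and of the mixed product in the first pair of variables;
      evaluation at (1,1) yields the mixed one.\<close>
    have T0: "dot (g 0) (bil M (e 0) b) = 0" for b
      using T[of "e 0" b] by (simp add: e_def expand)
    have T1: "dot (g 1) (bil M (e 1) b) = 0" for b
      using T[of "e 1" b] by (simp add: e_def expand)
    have T01: "dot (g 0) (bil M (e 1) b) + dot (g 1) (bil M (e 0) b) = 0" for b
    proof -
      have "bil M (\<lambda>_. 1) b = (\<lambda>i. bil M (e 0) b i + bil M (e 1) b i)"
        by (auto simp: bil_def sum_bit e_def algebra_simps)
      then show ?thesis
        using T[of "\<lambda>_. 1" b] T0[of b] T1[of b]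
        by (simp add: dot_def sum.distrib algebra_simps)
    qed
    \<comment> \<open>By this coincidence three vectors span all values:
      \<open>bil M (e 0) m\<close>, \<open>bil M (e 1) m'\<close> and the one appearing on both
      sides here. The last is killed by \<open>g 0\<close> through \<open>T0\<close> in its first
      shape and by \<open>g 1\<close> through \<open>T1\<close> in its second; \<open>T01\<close>
      then handles the other two.\<close>
    have sym: "bil M (e 0) m' = bil M (e 1) m"
      using 2(2)[of "e 0" "e 1"] by (simp add: e_def)
    have Z: "dot (g p) (bil M (e 0) m') = 0" for p
      using T0[of m'] T1[of m] sym bit_cases[of p] by auto
    have X: "dot (g p) (bil M (e 0) m) = 0" for p
      using T0[of m] T01[of m] Z[of 0] sym bit_cases[of p] by auto
    have Y: "dot (g p) (bil M (e 1) m') = 0" for p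
      using T1[of m'] T01[of m'] Z[of 1] bit_cases[of p] by auto
    have "dot (g p) (bil M a b) = 0" for p a b
    proof -
      define d where "d = det2 m m'"
      have d: "d \<noteq> 0"
        using 2(1) by (simp add: d_def)
      have b: "b = (\<lambda>q. (det2 b m' / d) * m q + (det2 m b / d) * m' q)"
      proof
        fix q
        have "det2 b m' * m q + det2 m b * m' q = d * b q"
          using bit_cases[of q] by (auto simp: d_def det2_def algebra_simps)
        then show "b q = (det2 b m' / d) * m q + (det2 m b / d) * m' q"
          using d by (simp add: field_simps)
      qed
      have "bil M a b = bil M (\<lambda>p. a 0 * e 0 p + a 1 * e 1 p)
          (\<lambda>q. (det2 b m' / d) * m q + (det2 m b / d) * m' q)"
        by (rule arg_cong2[OF e b])
      also have "\<dots> = (\<lambda>i. a 0 * (det2 b m' / d) * bil M (e 0) m i +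
          (a 0 * (det2 m b / d) + a 1 * (det2 b m' / d)) * bil M (e 0) m' i +
          a 1 * (det2 m b / d) * bil M (e 1) m' i)"
        by (rule ext) (simp only: bil_combination sym, simp add: algebra_simps)
      finally show ?thesis
        by (simp only: dot_combination X Y Z mult_zero_right add_0_left)
    qed
    then have "g p = (\<lambda>_. 0)" for p
      using assms unfolding nondegenerate_def by blast
    then have "G = (\<lambda>_ _. 0)"
      by (auto simp: g_def fun_eq_iff)
    with G(2) show ?thesis
      by simp
  qed
qed

section \<open>Evaluation of polynomials\<close>

text \<open>Summing over a larger set of monomials, and multiplying over all variables, adds only
  neutral terms. It lets polynomials with different supports be evaluated over one common index
  set.\<close>

lemma mpoly_eval_superset:
  fixes p :: "('v::finite, 'k::comm_semiring_1) mpoly"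
  assumes "finite K" "Poly_Mapping.keys p \<subseteq> K"
  shows "mpoly_eval a p =
    (\<Sum>m\<in>K. Poly_Mapping.lookup p m * (\<Prod>v\<in>UNIV. a v ^ Poly_Mapping.lookup m v))"
proof -
  have "(\<Prod>v\<in>Poly_Mapping.keys m. a v ^ Poly_Mapping.lookup m v) =
      (\<Prod>v\<in>UNIV. a v ^ Poly_Mapping.lookup m v)" for m :: "'v \<Rightarrow>\<^sub>0 nat"
    by (rule prod.mono_neutral_left) (auto simp: in_keys_iff)
  then show ?thesis
    unfolding mpoly_eval_def using assms
    by (auto intro!: sum.mono_neutral_left simp: in_keys_iff)
qed

lemma mpoly_eval_zero: "mpoly_eval a 0 = 0"
  by (simp add: mpoly_eval_def)

lemma mpoly_eval_single:
  fixes a :: "'v::finite \<Rightarrow> 'k::comm_semiring_1"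
  shows "mpoly_eval a (Poly_Mapping.single m c) = c * (\<Prod>v\<in>UNIV. a v ^ Poly_Mapping.lookup m v)"
  by (subst mpoly_eval_superset[of "{m}"]) auto

lemma mpoly_eval_add:
  fixes a :: "'v::finite \<Rightarrow> 'k::comm_semiring_1"
  shows "mpoly_eval a (p + q) = mpoly_eval a p + mpoly_eval a q"
proof -
  let ?K = "Poly_Mapping.keys p \<union> Poly_Mapping.keys q"
  have "mpoly_eval a r = (\<Sum>m\<in>?K. Poly_Mapping.lookup r m * (\<Prod>v\<in>UNIV. a v ^ Poly_Mapping.lookup m v))"
    if "r \<in> {p, q, p + q}" for r
    using that keys_add[of p q] by (intro mpoly_eval_superset) auto
  then show ?thesis
    by (simp add: lookup_add distrib_right sum.distrib)
qed

lemma mpoly_eval_sum: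
  fixes a :: "'v::finite \<Rightarrow> 'k::comm_semiring_1"
  shows "mpoly_eval a (sum h I) = (\<Sum>i\<in>I. mpoly_eval a (h i))"
  by (induction I rule: infinite_finite_induct) (simp_all add: mpoly_eval_zero mpoly_eval_add)

lemma mpoly_eq_sum_single:
  "(\<Sum>m\<in>Poly_Mapping.keys p. Poly_Mapping.single m (Poly_Mapping.lookup p m)) = p"
  by (rule poly_mapping_eqI) (simp add: lookup_sum lookup_single when_def in_keys_iff)

lemma mpoly_eval_mult:
  fixes a :: "'v::finite \<Rightarrow> 'k::comm_semiring_1"
  shows "mpoly_eval a (p * q) = mpoly_eval a p * mpoly_eval a q"
proof -
  have single: "mpoly_eval a (Poly_Mapping.single m c * Poly_Mapping.single n d) =
      mpoly_eval a (Poly_Mapping.single m c) * mpoly_eval a (Poly_Mapping.single n d)" for m n c d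
    by (simp add: mult_single mpoly_eval_single lookup_add power_add prod.distrib algebra_simps)
  \<comment> \<open>Both sides are biadditive, so multiplicativity needs checking only on single
    terms, where exponents add.\<close>
  have "mpoly_eval a (sum h I * sum g J) = mpoly_eval a (sum h I) * mpoly_eval a (sum g J)"
    if "\<And>i j. mpoly_eval a (h i * g j) = mpoly_eval a (h i) * mpoly_eval a (g j)"
    for h g :: "('v \<Rightarrow>\<^sub>0 nat) \<Rightarrow> ('v, 'k) mpoly" and I J
    by (simp add: sum_product mpoly_eval_sum that)
  from this[of "\<lambda>m. Poly_Mapping.single m (Poly_Mapping.lookup p m)"
      "\<lambda>m. Poly_Mapping.single m (Poly_Mapping.lookup q m)"
      "Poly_Mapping.keys p" "Poly_Mapping.keys q", OF single]
  show ?thesis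
    by (simp only: mpoly_eq_sum_single)
qed

section \<open>Linear forms\<close>

definition linform :: "('v \<Rightarrow> 'k) \<Rightarrow> ('v::finite, 'k::field) mpoly" where
  "linform c = (\<Sum>v\<in>UNIV. Poly_Mapping.single (Poly_Mapping.single v 1) (c v))"

lemma prod_power_single:
  fixes a :: "'v::finite \<Rightarrow> 'k::comm_semiring_1"
  shows "(\<Prod>w\<in>UNIV. a w ^ Poly_Mapping.lookup (Poly_Mapping.single v 1) w) = a v"
proof -
  have "(\<Prod>w\<in>UNIV. a w ^ Poly_Mapping.lookup (Poly_Mapping.single v 1) w) =
      (\<Prod>w\<in>UNIV. if w = v then a w else 1)"
    by (rule prod.cong) (auto simp: lookup_single when_def)
  then show ?thesis
    by simp
qed

lemma mpoly_eval_linform: "mpoly_eval a (linform c) = dot c a"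
  by (simp add: linform_def mpoly_eval_sum mpoly_eval_single prod_power_single[unfolded One_nat_def] dot_def)

lemma sum_lookup_single: "(\<Sum>w\<in>UNIV. Poly_Mapping.lookup (Poly_Mapping.single (v :: 'v::finite) (1 :: nat)) w) = 1"
  by (simp add: lookup_single when_def)

lemma homogeneous_linform: "homogeneous 1 (linform c)"
proof -
  have "m \<in> Poly_Mapping.keys (linform c) \<Longrightarrow> \<exists>v. m = Poly_Mapping.single v 1" for m
    unfolding linform_def using keys_sum by (fastforce split: if_splits)
  then show ?thesis
    unfolding homogeneous_def using sum_lookup_single by fastforce
qed

section \<open>Rescaling of homogeneous coordinates\<close>

lemma mpoly_eval_homogeneous_scale:
  assumes "homogeneous d s"
  shows "mpoly_eval (\<lambda>i. c * a i) s = c ^ d * mpoly_eval a s"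
proof -
  have "(\<Prod>v\<in>UNIV. (c * a v) ^ Poly_Mapping.lookup m v) =
      c ^ d * (\<Prod>v\<in>UNIV. a v ^ Poly_Mapping.lookup m v)" if "m \<in> Poly_Mapping.keys s" for m
    using that assms
    by (simp add: power_mult_distrib prod.distrib homogeneous_def flip: power_sum)
  then show ?thesis
    by (simp add: mpoly_eval_superset[OF finite_keys order_refl] sum_distrib_left mult.left_commute
        cong: sum.cong)
qed

lemma prod_UNIV_sum:
  "(\<Prod>v\<in>(UNIV :: ('i::finite + 'j::finite) set). h v) = (\<Prod>i\<in>UNIV. h (Inl i)) * (\<Prod>j\<in>UNIV. h (Inr j))"
  unfolding UNIV_Plus_UNIV[symmetric] by (subst prod.Plus) (simp_all add: comp_def)

lemma mpoly_eval_bihomogeneous_scale: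
  assumes "bihomogeneous p q s"
  shows "mpoly_eval (case_sum (\<lambda>i. c * a i) (\<lambda>j. d * b j)) s =
    c ^ p * d ^ q * mpoly_eval (case_sum a b) s"
proof -
  have "(\<Prod>v\<in>UNIV. case_sum (\<lambda>i. c * a i) (\<lambda>j. d * b j) v ^ Poly_Mapping.lookup m v) =
      c ^ p * d ^ q * (\<Prod>v\<in>UNIV. case_sum a b v ^ Poly_Mapping.lookup m v)"
    if "m \<in> Poly_Mapping.keys s" for m
    using that assms
    by (simp add: prod_UNIV_sum power_mult_distrib prod.distrib bihomogeneous_def mult_ac flip: power_sum)
  then show ?thesis
    by (simp add: mpoly_eval_superset[OF finite_keys order_refl] sum_distrib_left mult.left_commute
        cong: sum.cong)
qed

section \<open>Forms of low bidegree\<close>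

definition xvar :: "2 \<Rightarrow> (2 + 2 \<Rightarrow>\<^sub>0 nat)" where
  "xvar p = Poly_Mapping.single (Inl p) 1"

definition uvar :: "2 \<Rightarrow> (2 + 2 \<Rightarrow>\<^sub>0 nat)" where
  "uvar q = Poly_Mapping.single (Inr q) 1"

definition xmon :: "2 \<Rightarrow> (2 + 2, 'k::field) mpoly" where
  "xmon p = Poly_Mapping.single (xvar p) 1"

definition umon :: "2 \<Rightarrow> (2 + 2, 'k::field) mpoly" where
  "umon q = Poly_Mapping.single (uvar q) 1"

abbreviation const :: "'k \<Rightarrow> (2 + 2, 'k::field) mpoly" where
  "const \<equiv> Poly_Mapping.single 0"

definition coeffs11 :: "('n \<Rightarrow> (2 + 2, 'k::field) mpoly) \<Rightarrow> 'n \<Rightarrow> 2 \<Rightarrow> 2 \<Rightarrow> 'k" where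
  "coeffs11 f i p q = Poly_Mapping.lookup (f i) (xvar p + uvar q)"

lemma lookup_vars:
  "Poly_Mapping.lookup (xvar p) (Inl r) = of_bool (p = r)"
  "Poly_Mapping.lookup (xvar p) (Inr r) = 0"
  "Poly_Mapping.lookup (uvar q) (Inl r) = 0"
  "Poly_Mapping.lookup (uvar q) (Inr r) = of_bool (q = r)"
  by (auto simp: xvar_def uvar_def lookup_single when_def)

lemma sum_bit_eq_1:
  fixes h :: "2 \<Rightarrow> nat"
  assumes "(\<Sum>p\<in>UNIV. h p) = 1"
  obtains p where "\<And>r. h r = of_bool (p = r)"
proof -
  have "h 0 = 1 \<and> h 1 = 0 \<or> h 0 = 0 \<and> h 1 = 1"
    using assms by (simp add: sum_bit) arith
  then show ?thesis
  proof
    assume "h 0 = 1 \<and> h 1 = 0"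
    then have "h r = of_bool (0 = r)" for r
      using bit_cases[of r] by auto
    then show ?thesis ..
  next
    assume "h 0 = 0 \<and> h 1 = 1"
    then have "h r = of_bool (1 = r)" for r
      using bit_cases[of r] by auto
    then show ?thesis ..
  qed
qed

lemma monomial_eqI:
  fixes m m' :: "'i + 'j \<Rightarrow>\<^sub>0 nat"
  assumes "\<And>r. Poly_Mapping.lookup m (Inl r) = Poly_Mapping.lookup m' (Inl r)"
    "\<And>r. Poly_Mapping.lookup m (Inr r) = Poly_Mapping.lookup m' (Inr r)"
  shows "m = m'"
proof (rule poly_mapping_eqI)
  show "Poly_Mapping.lookup m v = Poly_Mapping.lookup m' v" for v
    using assms by (cases v) auto
qed

lemma bihomogeneous_11_keys:
  fixes s :: "(2 + 2, 'k::field) mpoly"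
  assumes "bihomogeneous 1 1 s" "m \<in> Poly_Mapping.keys s"
  obtains p q where "m = xvar p + uvar q"
proof -
  obtain p where p: "\<And>r. Poly_Mapping.lookup m (Inl r) = of_bool (p = r)"
    by (rule sum_bit_eq_1[of "\<lambda>r. Poly_Mapping.lookup m (Inl r)"])
      (use assms in \<open>auto simp: bihomogeneous_def\<close>)
  obtain q where q: "\<And>r. Poly_Mapping.lookup m (Inr r) = of_bool (q = r)"
    by (rule sum_bit_eq_1[of "\<lambda>r. Poly_Mapping.lookup m (Inr r)"])
      (use assms in \<open>auto simp: bihomogeneous_def\<close>)
  have "m = xvar p + uvar q"
    by (rule monomial_eqI) (simp_all add: lookup_add lookup_vars p q)
  then show ?thesis ..
qed

lemma bihomogeneous_10_keys:
  fixes s :: "(2 + 2, 'k::field) mpoly"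
  assumes "bihomogeneous 1 0 s" "m \<in> Poly_Mapping.keys s"
  obtains p where "m = xvar p"
proof -
  obtain p where p: "\<And>r. Poly_Mapping.lookup m (Inl r) = of_bool (p = r)"
    by (rule sum_bit_eq_1[of "\<lambda>r. Poly_Mapping.lookup m (Inl r)"])
      (use assms in \<open>auto simp: bihomogeneous_def\<close>)
  have q: "Poly_Mapping.lookup m (Inr r) = 0" for r
    using assms by (auto simp: bihomogeneous_def)
  have "m = xvar p"
    by (rule monomial_eqI) (simp_all add: lookup_vars p q)
  then show ?thesis ..
qed

lemma bihomogeneous_01_keys:
  fixes s :: "(2 + 2, 'k::field) mpoly"
  assumes "bihomogeneous 0 1 s" "m \<in> Poly_Mapping.keys s"
  obtains q where "m = uvar q"
proof -
  obtain q where q: "\<And>r. Poly_Mapping.lookup m (Inr r) = of_bool (q = r)"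
    by (rule sum_bit_eq_1[of "\<lambda>r. Poly_Mapping.lookup m (Inr r)"])
      (use assms in \<open>auto simp: bihomogeneous_def\<close>)
  have p: "Poly_Mapping.lookup m (Inl r) = 0" for r
    using assms by (auto simp: bihomogeneous_def)
  have "m = uvar q"
    by (rule monomial_eqI) (simp_all add: lookup_vars p q)
  then show ?thesis ..
qed

lemma var_eq_iff:
  "xvar p = xvar r \<longleftrightarrow> p = r" "uvar p = uvar r \<longleftrightarrow> p = r"
  "xvar p + uvar q = xvar r + uvar s \<longleftrightarrow> p = r \<and> q = s"
proof -
  show x: "xvar p = xvar r \<longleftrightarrow> p = r"
    by (metis lookup_vars(1) of_bool_eq_1_iff)
  show u: "uvar p = uvar r \<longleftrightarrow> p = r" for p r
    by (metis lookup_vars(4) of_bool_eq_1_iff)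
  show "xvar p + uvar q = xvar r + uvar s \<longleftrightarrow> p = r \<and> q = s"
  proof
    assume *: "xvar p + uvar q = xvar r + uvar s"
    have "of_bool (p = r) = (1 :: nat)"
      using arg_cong[OF *, of "\<lambda>m. Poly_Mapping.lookup m (Inl r)"]
      unfolding lookup_add lookup_vars by (simp only: simp_thms of_bool_eq add_0_right)
    moreover have "of_bool (q = s) = (1 :: nat)"
      using arg_cong[OF *, of "\<lambda>m. Poly_Mapping.lookup m (Inr s)"]
      unfolding lookup_add lookup_vars by (simp only: simp_thms of_bool_eq add_0_left)
    ultimately show "p = r \<and> q = s"
      by (simp only: of_bool_eq_1_iff)
  qed simp
qed

lemma bihomogeneous_11_expand:
  assumes "bihomogeneous 1 1 (f i)"
  shows "f i = (\<Sum>p\<in>UNIV. \<Sum>q\<in>UNIV. const (coeffs11 f i p q) * xmon p * umon q)"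
proof (rule poly_mapping_eqI)
  fix m
  have rhs: "Poly_Mapping.lookup (\<Sum>p\<in>UNIV. \<Sum>q\<in>UNIV. const (coeffs11 f i p q) * xmon p * umon q) m =
      (\<Sum>p\<in>UNIV. \<Sum>q\<in>UNIV. if xvar p + uvar q = m then coeffs11 f i p q else 0)"
    by (simp add: lookup_sum xmon_def umon_def mult_single lookup_single when_def)
  show "Poly_Mapping.lookup (f i) m =
      Poly_Mapping.lookup (\<Sum>p\<in>UNIV. \<Sum>q\<in>UNIV. const (coeffs11 f i p q) * xmon p * umon q) m"
  proof (cases "\<exists>p q. m = xvar p + uvar q")
    case True
    then obtain p q where m: "m = xvar p + uvar q"
      by blast
    show ?thesis
      unfolding rhs unfolding m var_eq_iff using bit_cases[of p] bit_cases[of q]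
      by (elim disjE) (simp_all add: sum_bit coeffs11_def)
  next
    case False
    then have ne: "xvar p + uvar q \<noteq> m" for p q
      by blast
    have "m \<notin> Poly_Mapping.keys (f i)"
      using bihomogeneous_11_keys[OF assms] False by blast
    then show ?thesis
      unfolding rhs using ne by (simp add: in_keys_iff)
  qed
qed

lemma bihomogeneous_10_expand:
  assumes "bihomogeneous 1 0 s"
  shows "s = (\<Sum>p\<in>UNIV. const (Poly_Mapping.lookup s (xvar p)) * xmon p)"
proof (rule poly_mapping_eqI)
  fix m
  have rhs: "Poly_Mapping.lookup (\<Sum>p\<in>UNIV. const (Poly_Mapping.lookup s (xvar p)) * xmon p) m =
      (\<Sum>p\<in>UNIV. if xvar p = m then Poly_Mapping.lookup s (xvar p) else 0)"
    by (simp add: lookup_sum xmon_def mult_single lookup_single when_def)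
  show "Poly_Mapping.lookup s m =
      Poly_Mapping.lookup (\<Sum>p\<in>UNIV. const (Poly_Mapping.lookup s (xvar p)) * xmon p) m"
  proof (cases "\<exists>p. m = xvar p")
    case True
    then show ?thesis
      unfolding rhs by (auto simp: var_eq_iff)
  next
    case False
    then have ne: "xvar p \<noteq> m" for p
      by blast
    have "m \<notin> Poly_Mapping.keys s"
      using bihomogeneous_10_keys[OF assms] False by blast
    then show ?thesis
      unfolding rhs using ne by (simp add: in_keys_iff)
  qed
qed

lemma bihomogeneous_01_expand:
  assumes "bihomogeneous 0 1 s"
  shows "s = (\<Sum>q\<in>UNIV. const (Poly_Mapping.lookup s (uvar q)) * umon q)"
proof (rule poly_mapping_eqI)
  fix m
  have rhs: "Poly_Mapping.lookup (\<Sum>q\<in>UNIV. const (Poly_Mapping.lookup s (uvar q)) * umon q) m =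
      (\<Sum>q\<in>UNIV. if uvar q = m then Poly_Mapping.lookup s (uvar q) else 0)"
    by (simp add: lookup_sum umon_def mult_single lookup_single when_def)
  show "Poly_Mapping.lookup s m =
      Poly_Mapping.lookup (\<Sum>q\<in>UNIV. const (Poly_Mapping.lookup s (uvar q)) * umon q) m"
  proof (cases "\<exists>q. m = uvar q")
    case True
    then show ?thesis
      unfolding rhs by (auto simp: var_eq_iff)
  next
    case False
    then have ne: "uvar q \<noteq> m" for q
      by blast
    have "m \<notin> Poly_Mapping.keys s"
      using bihomogeneous_01_keys[OF assms] False by blast
    then show ?thesis
      unfolding rhs using ne by (simp add: in_keys_iff)
  qed
qed

lemma mpoly_eval_const: "mpoly_eval a (const c) = c"
  by (simp add: mpoly_eval_single)

lemma mpoly_eval_mons: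
  "mpoly_eval (case_sum a b) (xmon p) = a p" "mpoly_eval (case_sum a b) (umon q) = b q"
  using prod_power_single[of "case_sum a b" "Inl p"] prod_power_single[of "case_sum a b" "Inr q"]
  by (simp_all add: xmon_def umon_def mpoly_eval_single xvar_def uvar_def)

lemma mpoly_eval_bihomogeneous_11:
  assumes "\<And>i. bihomogeneous 1 1 (f i)"
  shows "(\<lambda>i. mpoly_eval (case_sum a b) (f i)) = bil (coeffs11 f) a b"
  by (rule ext, subst bihomogeneous_11_expand[of f, OF assms])
    (simp add: mpoly_eval_sum mpoly_eval_mult mpoly_eval_const mpoly_eval_mons bil_def)

lemma bihomogeneous_xform: "bihomogeneous 1 0 (\<Sum>p\<in>UNIV. const (c p) * xmon p)"
  unfolding bihomogeneous_def
proof
  fix m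
  assume "m \<in> Poly_Mapping.keys (\<Sum>p\<in>UNIV. const (c p) * xmon p)"
  then obtain p where "m \<in> Poly_Mapping.keys (const (c p) * xmon p)"
    using keys_sum[of "\<lambda>p. const (c p) * xmon p" UNIV] by blast
  then have "m = xvar p"
    by (simp add: xmon_def mult_single split: if_splits)
  then show "(\<Sum>i\<in>UNIV. Poly_Mapping.lookup m (Inl i)) = 1 \<and>
      (\<Sum>j\<in>UNIV. Poly_Mapping.lookup m (Inr j)) = 0"
    by (simp add: lookup_vars)
qed

lemma bihomogeneous_uform: "bihomogeneous 0 1 (\<Sum>p\<in>UNIV. const (c p) * umon p)"
  unfolding bihomogeneous_def
proof
  fix m
  assume "m \<in> Poly_Mapping.keys (\<Sum>p\<in>UNIV. const (c p) * umon p)"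
  then obtain p where "m \<in> Poly_Mapping.keys (const (c p) * umon p)"
    using keys_sum[of "\<lambda>p. const (c p) * umon p" UNIV] by blast
  then have "m = uvar p"
    by (simp add: umon_def mult_single split: if_splits)
  then show "(\<Sum>i\<in>UNIV. Poly_Mapping.lookup m (Inl i)) = 0 \<and>
      (\<Sum>j\<in>UNIV. Poly_Mapping.lookup m (Inr j)) = 1"
    by (simp add: lookup_vars)
qed

section \<open>Linear syzygies as polynomial syzygies\<close>

text \<open>
  A linear syzygy on values already holds on coefficients, hence on any elements \<open>X p\<close>, \<open>U q\<close>
  of the polynomial ring.
\<close>

lemma linear_syzygy_lift:
  fixes X U :: "2 \<Rightarrow> (2 + 2, 'k::field) mpoly"
  assumes "linear_syzygy M G"
  shows "(\<Sum>i\<in>UNIV. (\<Sum>r\<in>UNIV. const (G i r) * X r) *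
    (\<Sum>p\<in>UNIV. \<Sum>q\<in>UNIV. const (M i p q) * X p * U q)) = 0"
proof -
  define T where "T r p q = (\<Sum>i\<in>UNIV. G i r * M i p q)" for r p q
  have val: "dot (\<lambda>i. dot (G i) a) (bil M a b) =
      (\<Sum>r\<in>UNIV. \<Sum>p\<in>UNIV. \<Sum>q\<in>UNIV. T r p q * a r * a p * b q)" for a b
    by (simp add: dot_def bil_def sum_bit T_def sum.distrib sum_distrib_left sum_distrib_right algebra_simps)
  have zero: "(\<Sum>r\<in>UNIV. \<Sum>p\<in>UNIV. \<Sum>q\<in>UNIV. T r p q * a r * a p * b q) = 0" for a b
    using assms unfolding linear_syzygy_def val by blast
  \<comment> \<open>Evaluation at (1,0), (0,1) and (1,1) isolates the three quadratic monomials.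
    Only the sum \<open>T 0 1 q + T 1 0 q\<close> is accessible, and only this sum is needed because
    \<open>X 0\<close> and \<open>X 1\<close> commute.\<close>
  have T: "T 0 0 q = 0" "T 1 1 q = 0" "T 0 1 q + T 1 0 q = 0" for q
    using zero[of "\<lambda>r. of_bool (r = 0)" "\<lambda>r. of_bool (r = q)"]
      zero[of "\<lambda>r. of_bool (r = 1)" "\<lambda>r. of_bool (r = q)"]
      zero[of "\<lambda>r. 1" "\<lambda>r. of_bool (r = q)"] bit_cases[of q]
    by (auto simp: sum_bit add_ac)
  have const_sum: "const (sum h I) = (\<Sum>i\<in>I. const (h i))" for h :: "'a \<Rightarrow> 'k" and I
    by (induction I rule: infinite_finite_induct) (simp_all add: single_add)
  have const_mult: "const (x * y) = const x * const y" for x y :: 'k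
    by (simp add: mult_single)
  have C: "const (T r p q) = (\<Sum>i\<in>UNIV. const (G i r) * const (M i p q))" for r p q
    by (simp add: T_def const_sum const_mult)
  have "(\<Sum>i\<in>UNIV. (\<Sum>r\<in>UNIV. const (G i r) * X r) *
      (\<Sum>p\<in>UNIV. \<Sum>q\<in>UNIV. const (M i p q) * X p * U q)) =
      (\<Sum>r\<in>UNIV. \<Sum>p\<in>UNIV. \<Sum>q\<in>UNIV. const (T r p q) * X r * X p * U q)"
    unfolding C
    by (simp add: sum_bit sum.distrib sum_distrib_left sum_distrib_right algebra_simps)
  also have "\<dots> = (\<Sum>q\<in>UNIV. const (T 0 0 q) * X 0 * X 0 * U q + const (T 1 1 q) * X 1 * X 1 * U q
      + const (T 0 1 q + T 1 0 q) * X 0 * X 1 * U q)"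
    by (simp add: sum_bit single_add algebra_simps)
  finally show ?thesis
    by (simp add: T)
qed

text \<open>A form of bidegree (1,0) is determined by its two coefficients, which become the rows of
  \<open>G\<close>. Evaluation leads from polynomials to values, and
  \<open>linear_syzygy_lift\<close> leads back.\<close>

lemma syzygy_10_iff:
  fixes f :: "'n::finite \<Rightarrow> (2 + 2, 'k::field) mpoly"
  assumes "\<And>i. bihomogeneous 1 1 (f i)"
  shows "(\<exists>g. syzygy 1 0 f g \<and> g \<noteq> (\<lambda>_. 0)) \<longleftrightarrow> (\<exists>G. linear_syzygy (coeffs11 f) G \<and> G \<noteq> (\<lambda>_ _. 0))"
proof
  assume "\<exists>g. syzygy 1 0 f g \<and> g \<noteq> (\<lambda>_. 0)"
  then obtain g where g: "\<And>i. bihomogeneous 1 0 (g i)" "(\<Sum>i\<in>UNIV. g i * f i) = 0" "g \<noteq> (\<lambda>_. 0)"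
    unfolding syzygy_def by blast
  define G where "G i p = Poly_Mapping.lookup (g i) (xvar p)" for i p
  have expand: "g i = (\<Sum>p\<in>UNIV. const (G i p) * xmon p)" for i
    unfolding G_def by (rule bihomogeneous_10_expand[OF g(1)])
  have eval_g: "mpoly_eval (case_sum a b) (g i) = dot (G i) a" for a b i
    by (simp add: expand mpoly_eval_sum mpoly_eval_mult mpoly_eval_const mpoly_eval_mons dot_def)
  have "dot (\<lambda>i. dot (G i) a) (bil (coeffs11 f) a b) = mpoly_eval (case_sum a b) (\<Sum>i\<in>UNIV. g i * f i)" for a b
    unfolding mpoly_eval_bihomogeneous_11[of f, OF assms, symmetric]
    by (simp only: mpoly_eval_sum mpoly_eval_mult eval_g dot_def)
  then have "linear_syzygy (coeffs11 f) G"
    by (simp add: linear_syzygy_def g(2) mpoly_eval_zero)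
  moreover have "G \<noteq> (\<lambda>_ _. 0)"
  proof
    assume "G = (\<lambda>_ _. 0)"
    then have "g = (\<lambda>_. 0)"
      by (simp add: expand fun_eq_iff)
    with g(3) show False ..
  qed
  ultimately show "\<exists>G. linear_syzygy (coeffs11 f) G \<and> G \<noteq> (\<lambda>_ _. 0)"
    by blast
next
  assume "\<exists>G. linear_syzygy (coeffs11 f) G \<and> G \<noteq> (\<lambda>_ _. 0)"
  then obtain G where G: "linear_syzygy (coeffs11 f) G" "G \<noteq> (\<lambda>_ _. 0)"
    by blast
  define g :: "'n \<Rightarrow> (2 + 2, 'k) mpoly" where "g i = (\<Sum>p\<in>UNIV. const (G i p) * xmon p)" for i
  have "mpoly_eval (case_sum a b) (g i) = dot (G i) a" for a b i
    by (simp add: g_def mpoly_eval_sum mpoly_eval_mult mpoly_eval_const mpoly_eval_mons dot_def)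
  then have eval: "dot (G i) a = 0" if "g = (\<lambda>_. 0)" for i a
    using that by (metis mpoly_eval_zero)
  have "g \<noteq> (\<lambda>_. 0)"
  proof
    assume "g = (\<lambda>_. 0)"
    from eval[OF this] have "G i p = 0" for i p
      by (metis dot_indicator)
    with G(2) show False
      by (simp add: fun_eq_iff)
  qed
  moreover have "(\<Sum>i\<in>UNIV. g i * f i) = 0"
    using linear_syzygy_lift[OF G(1), of xmon umon]
    unfolding g_def bihomogeneous_11_expand[of f, OF assms, symmetric] .
  moreover have "bihomogeneous 1 0 (g i)" for i
    unfolding g_def by (rule bihomogeneous_xform)
  ultimately show "\<exists>g. syzygy 1 0 f g \<and> g \<noteq> (\<lambda>_. 0)"
    unfolding syzygy_def by blast
qed

lemma syzygy_01_iff: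
  fixes f :: "'n::finite \<Rightarrow> (2 + 2, 'k::field) mpoly"
  assumes "\<And>i. bihomogeneous 1 1 (f i)"
  shows "(\<exists>g. syzygy 0 1 f g \<and> g \<noteq> (\<lambda>_. 0)) \<longleftrightarrow>
    (\<exists>G. linear_syzygy (\<lambda>i p q. coeffs11 f i q p) G \<and> G \<noteq> (\<lambda>_ _. 0))"
    (is "_ \<longleftrightarrow> (\<exists>G. linear_syzygy ?M G \<and> _ G)")
proof
  assume "\<exists>g. syzygy 0 1 f g \<and> g \<noteq> (\<lambda>_. 0)"
  then obtain g where g: "\<And>i. bihomogeneous 0 1 (g i)" "(\<Sum>i\<in>UNIV. g i * f i) = 0" "g \<noteq> (\<lambda>_. 0)"
    unfolding syzygy_def by blast
  define G where "G i p = Poly_Mapping.lookup (g i) (uvar p)" for i p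
  have expand: "g i = (\<Sum>p\<in>UNIV. const (G i p) * umon p)" for i
    unfolding G_def by (rule bihomogeneous_01_expand[OF g(1)])
  have eval_g: "mpoly_eval (case_sum a b) (g i) = dot (G i) b" for a b i
    by (simp add: expand mpoly_eval_sum mpoly_eval_mult mpoly_eval_const mpoly_eval_mons dot_def)
  have "dot (\<lambda>i. dot (G i) b) (bil (?M) b a) = mpoly_eval (case_sum a b) (\<Sum>i\<in>UNIV. g i * f i)" for a b
    unfolding bil_swap[of "coeffs11 f"] mpoly_eval_bihomogeneous_11[of f, OF assms, symmetric]
    by (simp only: mpoly_eval_sum mpoly_eval_mult eval_g dot_def)
  then have "linear_syzygy (?M) G"
    by (simp add: linear_syzygy_def g(2) mpoly_eval_zero)
  moreover have "G \<noteq> (\<lambda>_ _. 0)"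
  proof
    assume "G = (\<lambda>_ _. 0)"
    then have "g = (\<lambda>_. 0)"
      by (simp add: expand fun_eq_iff)
    with g(3) show False ..
  qed
  ultimately show "\<exists>G. linear_syzygy ?M G \<and> G \<noteq> (\<lambda>_ _. 0)"
    by blast
next
  assume "\<exists>G. linear_syzygy ?M G \<and> G \<noteq> (\<lambda>_ _. 0)"
  then obtain G where G: "linear_syzygy ?M G" "G \<noteq> (\<lambda>_ _. 0)"
    by blast
  define g :: "'n \<Rightarrow> (2 + 2, 'k) mpoly" where "g i = (\<Sum>p\<in>UNIV. const (G i p) * umon p)" for i
  have "mpoly_eval (case_sum a b) (g i) = dot (G i) b" for a b i
    by (simp add: g_def mpoly_eval_sum mpoly_eval_mult mpoly_eval_const mpoly_eval_mons dot_def)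
  then have eval: "dot (G i) a = 0" if "g = (\<lambda>_. 0)" for i a
    using that by (metis mpoly_eval_zero)
  have "g \<noteq> (\<lambda>_. 0)"
  proof
    assume "g = (\<lambda>_. 0)"
    from eval[OF this] have "G i p = 0" for i p
      by (metis dot_indicator)
    with G(2) show False
      by (simp add: fun_eq_iff)
  qed
  moreover have "(\<Sum>i\<in>UNIV. g i * f i) = 0"
  proof -
    \<comment> \<open>Here the generality of \<open>linear_syzygy_lift\<close> is used:
      \<open>umon\<close> takes the place of the first pair of variables and \<open>xmon\<close>
      that of the second.\<close>
    have "(\<Sum>p\<in>UNIV. \<Sum>q\<in>UNIV. const (?M i p q) * umon p * xmon q) = f i" for i
      by (subst bihomogeneous_11_expand[of f, OF assms]) (simp add: sum_bit algebra_simps)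
    then show ?thesis
      using linear_syzygy_lift[OF G(1), of umon xmon] by (simp add: g_def)
  qed
  moreover have "bihomogeneous 0 1 (g i)" for i
    unfolding g_def by (rule bihomogeneous_uform)
  ultimately show "\<exists>g. syzygy 0 1 f g \<and> g \<noteq> (\<lambda>_. 0)"
    unfolding syzygy_def by blast
qed

section \<open>Points of projective space\<close>

lemma abs_proj_scale:
  assumes "a \<noteq> (\<lambda>_. 0)" "c \<noteq> 0"
  shows "abs_proj (\<lambda>i. c * a i) = abs_proj a"
proof -
  have "(\<lambda>i. c * a i) \<noteq> (\<lambda>_. 0)"
    using assms by (auto simp: fun_eq_iff)
  then have "proj_rel a (\<lambda>i. c * a i)"
    unfolding proj_rel_def using assms by blast
  then show ?thesis
    using Quotient3_rel[OF Quotient3_proj] by metis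
qed

lemma abs_proj_eqD:
  assumes "a \<noteq> (\<lambda>_. 0)" "b \<noteq> (\<lambda>_. 0)" "abs_proj a = abs_proj b"
  obtains c where "c \<noteq> 0" "b = (\<lambda>i. c * a i)"
proof -
  have "proj_rel x x" if "x \<noteq> (\<lambda>_. 0)" for x :: "'a \<Rightarrow> 'b"
    using that unfolding proj_rel_def by (intro conjI exI[of _ 1]) auto
  then have "proj_rel a b"
    using assms Quotient3_rel[OF Quotient3_proj, of a b] by blast
  then show ?thesis
    using that unfolding proj_rel_def by blast
qed

lemma abs_proj_cases:
  obtains a where "a \<noteq> (\<lambda>_. 0)" "P = abs_proj a"
proof
  show "rep_proj P \<noteq> (\<lambda>_. 0)"
    using Quotient3_rep_reflp[OF Quotient3_proj, of P] by (simp add: proj_rel_def)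
  show "P = abs_proj (rep_proj P)"
    using Quotient3_abs_rep[OF Quotient3_proj, of P] by simp
qed

section \<open>Zero loci of sets of forms\<close>

definition zero_locus :: "('i::finite, 'k::field) mpoly set \<Rightarrow> ('i, 'k) proj set" where
  "zero_locus S = {abs_proj a | a. a \<noteq> (\<lambda>_. 0) \<and> (\<forall>s\<in>S. mpoly_eval a s = 0)}"

definition bi_zero_locus ::
  "('i::finite + 'j::finite, 'k::field) mpoly set \<Rightarrow> (('i, 'k) proj \<times> ('j, 'k) proj) set" where
  "bi_zero_locus S = {(abs_proj a, abs_proj b) | a b.
     a \<noteq> (\<lambda>_. 0) \<and> b \<noteq> (\<lambda>_. 0) \<and> (\<forall>s\<in>S. mpoly_eval (case_sum a b) s = 0)}"

lemma proj_closed_zero_locus: "homogeneous d s \<Longrightarrow> proj_closed (zero_locus {s})"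
  unfolding proj_closed_def zero_locus_def by (intro exI[of _ "{s}"]) auto

lemma biproj_closed_bi_zero_locus: "bihomogeneous p q s \<Longrightarrow> biproj_closed (bi_zero_locus {s})"
  unfolding biproj_closed_def bi_zero_locus_def by (intro exI[of _ "{s}"]) auto

text \<open>Another representative of the point differs by a nonzero scalar, which multiplies each
  form by a power of it. Vanishing can therefore be tested on any chosen coordinates.\<close>

lemma abs_proj_mem_zero_locus:
  assumes "\<forall>s\<in>S. \<exists>d. homogeneous d s" "a \<noteq> (\<lambda>_. 0)"
  shows "abs_proj a \<in> zero_locus S \<longleftrightarrow> (\<forall>s\<in>S. mpoly_eval a s = 0)"
proof
  assume "abs_proj a \<in> zero_locus S"
  then obtain a' where a': "abs_proj a' = abs_proj a" "a' \<noteq> (\<lambda>_. 0)" "\<forall>s\<in>S. mpoly_eval a' s = 0"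
    unfolding zero_locus_def by auto
  obtain c where c: "c \<noteq> 0" "a = (\<lambda>i. c * a' i)"
    using a'(2) assms(2) a'(1) by (rule abs_proj_eqD)
  show "\<forall>s\<in>S. mpoly_eval a s = 0"
  proof
    fix s
    assume "s \<in> S"
    then obtain d where "homogeneous d s"
      using assms(1) by blast
    then show "mpoly_eval a s = 0"
      unfolding c(2) using a'(3) \<open>s \<in> S\<close> by (simp add: mpoly_eval_homogeneous_scale)
  qed
qed (use assms in \<open>auto simp: zero_locus_def\<close>)

lemma abs_proj_mem_bi_zero_locus:
  assumes "\<forall>s\<in>S. \<exists>p q. bihomogeneous p q s" "a \<noteq> (\<lambda>_. 0)" "b \<noteq> (\<lambda>_. 0)"
  shows "(abs_proj a, abs_proj b) \<in> bi_zero_locus S \<longleftrightarrow> (\<forall>s\<in>S. mpoly_eval (case_sum a b) s = 0)"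
proof
  assume "(abs_proj a, abs_proj b) \<in> bi_zero_locus S"
  then obtain a' b' where ab': "abs_proj a' = abs_proj a" "a' \<noteq> (\<lambda>_. 0)"
    "abs_proj b' = abs_proj b" "b' \<noteq> (\<lambda>_. 0)" "\<forall>s\<in>S. mpoly_eval (case_sum a' b') s = 0"
    unfolding bi_zero_locus_def by auto
  obtain c where c: "c \<noteq> 0" "a = (\<lambda>i. c * a' i)"
    using ab'(2) assms(2) ab'(1) by (rule abs_proj_eqD)
  obtain d where d: "d \<noteq> 0" "b = (\<lambda>i. d * b' i)"
    using ab'(4) assms(3) ab'(3) by (rule abs_proj_eqD)
  show "\<forall>s\<in>S. mpoly_eval (case_sum a b) s = 0"
  proof
    fix s
    assume "s \<in> S"
    then obtain p q where "bihomogeneous p q s"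
      using assms(1) by blast
    then show "mpoly_eval (case_sum a b) s = 0"
      unfolding c(2) d(2) using ab'(5) \<open>s \<in> S\<close> by (simp add: mpoly_eval_bihomogeneous_scale)
  qed
qed (use assms in \<open>auto simp: bi_zero_locus_def\<close>)

section \<open>Rational maps as single-valued relations\<close>

text \<open>Changing the coordinates of \<open>Q\<close> by a factor \<open>t\<close> multiplies the
  two image vectors by \<open>t ^ d\<close> and \<open>t ^ e\<close>, which leaves the image points
  unchanged.\<close>

lemma proj_bimap_single_valued:
  assumes "\<And>i. homogeneous d (A i)" "\<And>j. homogeneous e (B j)"
    and "(Q, R) \<in> proj_bimap A B" "(Q, R') \<in> proj_bimap A B"
  shows "R = R'"
proof -
  obtain c where c: "Q = abs_proj c" "c \<noteq> (\<lambda>_. 0)"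
    "(\<lambda>i. mpoly_eval c (A i)) \<noteq> (\<lambda>_. 0)" "(\<lambda>j. mpoly_eval c (B j)) \<noteq> (\<lambda>_. 0)"
    "R = (abs_proj (\<lambda>i. mpoly_eval c (A i)), abs_proj (\<lambda>j. mpoly_eval c (B j)))"
    using assms(3) unfolding proj_bimap_def by auto
  obtain c' where c': "Q = abs_proj c'" "c' \<noteq> (\<lambda>_. 0)"
    "R' = (abs_proj (\<lambda>i. mpoly_eval c' (A i)), abs_proj (\<lambda>j. mpoly_eval c' (B j)))"
    using assms(4) unfolding proj_bimap_def by auto
  have "abs_proj c = abs_proj c'"
    using c(1) c'(1) by simp
  then obtain t where t: "t \<noteq> 0" "c' = (\<lambda>i. t * c i)"
    using abs_proj_eqD[OF c(2) c'(2)] by blast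
  have "t ^ d \<noteq> 0" "t ^ e \<noteq> 0"
    using t(1) by simp_all
  then show ?thesis
    unfolding c(5) c'(3) t(2)
      mpoly_eval_homogeneous_scale[OF assms(1)] mpoly_eval_homogeneous_scale[OF assms(2)]
    by (simp add: abs_proj_scale[OF c(3)] abs_proj_scale[OF c(4)])
qed

lemma bil_scale: "bil M (\<lambda>p. c * a p) (\<lambda>q. d * b q) = (\<lambda>i. c * d * bil M a b i)"
  by (rule ext) (simp add: bil_def sum_bit algebra_simps)

lemma biproj_map_value:
  fixes f :: "'n::finite \<Rightarrow> (2 + 2, 'k::field) mpoly"
  assumes "\<And>i. bihomogeneous 1 1 (f i)" "a \<noteq> (\<lambda>_. 0)" "b \<noteq> (\<lambda>_. 0)"
    and "((abs_proj a, abs_proj b), Q) \<in> biproj_map f"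
  shows "Q = abs_proj (bil (coeffs11 f) a b)"
proof -
  obtain a' b' where ab': "abs_proj a = abs_proj a'" "abs_proj b = abs_proj b'"
    "a' \<noteq> (\<lambda>_. 0)" "b' \<noteq> (\<lambda>_. 0)" "bil (coeffs11 f) a' b' \<noteq> (\<lambda>_. 0)"
    "Q = abs_proj (bil (coeffs11 f) a' b')"
    using assms(4) unfolding biproj_map_def mpoly_eval_bihomogeneous_11[of f, OF assms(1)] by auto
  obtain c where c: "c \<noteq> 0" "a = (\<lambda>i. c * a' i)"
    using ab'(3) assms(2) ab'(1)[symmetric] by (rule abs_proj_eqD)
  obtain d where d: "d \<noteq> 0" "b = (\<lambda>i. d * b' i)"
    using ab'(4) assms(3) ab'(2)[symmetric] by (rule abs_proj_eqD)
  have "c * d \<noteq> 0"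
    using c(1) d(1) by simp
  then show ?thesis
    unfolding c(2) d(2) bil_scale ab'(6) by (rule abs_proj_scale[OF ab'(5), symmetric])
qed

lemma biproj_mapI:
  fixes f :: "'n::finite \<Rightarrow> (2 + 2, 'k::field) mpoly"
  assumes "\<And>i. bihomogeneous 1 1 (f i)" "a \<noteq> (\<lambda>_. 0)" "b \<noteq> (\<lambda>_. 0)"
    and "bil (coeffs11 f) a b \<noteq> (\<lambda>_. 0)"
  shows "((abs_proj a, abs_proj b), abs_proj (bil (coeffs11 f) a b)) \<in> biproj_map f"
  unfolding biproj_map_def mpoly_eval_bihomogeneous_11[of f, OF assms(1)] using assms by blast

section \<open>Dominance and base points\<close>

text \<open>A functional \<open>c\<close> killing all values confines the image to the zero locus of
  \<open>linform c\<close>. By dominance this locus is everything, so \<open>c\<close> vanishes on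
  the unit vectors.\<close>

lemma dominant_imp_nondegenerate:
  fixes f :: "'n::finite \<Rightarrow> (2 + 2, 'k::field) mpoly"
  assumes "\<And>i. bihomogeneous 1 1 (f i)" "dominant f"
  shows "nondegenerate (coeffs11 f)"
  unfolding nondegenerate_def
proof (intro allI impI)
  fix c :: "'n \<Rightarrow> 'k"
  assume c: "\<forall>a b. dot c (bil (coeffs11 f) a b) = 0"
  have hom: "\<forall>s\<in>{linform c}. \<exists>d. homogeneous d s"
    using homogeneous_linform by blast
  have "Range (biproj_map f) \<subseteq> zero_locus {linform c}"
    unfolding biproj_map_def mpoly_eval_bihomogeneous_11[of f, OF assms(1)]
    using abs_proj_mem_zero_locus[OF hom] c by (auto simp: mpoly_eval_linform)
  then have all: "zero_locus {linform c} = UNIV"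
    using assms(2) proj_closed_zero_locus[OF homogeneous_linform] unfolding dominant_def by blast
  show "c = (\<lambda>_. 0)"
  proof
    fix j :: 'n
    let ?e = "\<lambda>i. of_bool (i = j) :: 'k"
    have "?e \<noteq> (\<lambda>_. 0)"
      by (auto dest: fun_cong[of _ _ j])
    from abs_proj_mem_zero_locus[OF hom this] show "c j = 0"
      by (simp add: all mpoly_eval_linform dot_indicator)
  qed
qed

lemma bihomogeneous_combination:
  fixes f :: "'n::finite \<Rightarrow> (2 + 2, 'k::field) mpoly"
  assumes "\<And>i. bihomogeneous p q (f i)"
  shows "bihomogeneous p q (\<Sum>i\<in>UNIV. const (c i) * f i)"
  unfolding bihomogeneous_def
proof
  fix m
  assume "m \<in> Poly_Mapping.keys (\<Sum>i\<in>UNIV. const (c i) * f i)"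
  then obtain i where "m \<in> Poly_Mapping.keys (const (c i) * f i)"
    using keys_sum[of "\<lambda>i. const (c i) * f i" UNIV] by blast
  then have "m \<in> Poly_Mapping.keys (f i)"
    using keys_mult[of "const (c i)" "f i"] by (auto split: if_splits)
  then show "(\<Sum>i\<in>UNIV. Poly_Mapping.lookup m (Inl i)) = p \<and>
      (\<Sum>j\<in>UNIV. Poly_Mapping.lookup m (Inr j)) = q"
    using assms unfolding bihomogeneous_def by blast
qed

text \<open>The inverse from the normal form is given by linear forms. Both composites multiply
  coordinate vectors by scalars: \<open>dot \<gamma> c\<close> on the plane, and
  \<open>det2 m b\<close> and \<open>det2 n a\<close> on the two factors. They are the identity
  wherever \<open>\<gamma>\<close> does not vanish.\<close>

lemma base_point_imp_birational:
  fixes f :: "3 \<Rightarrow> (2 + 2, 'k::field) mpoly"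
  assumes f: "\<And>i. bihomogeneous 1 1 (f i)"
    and "nondegenerate (coeffs11 f)" "has_base_point (coeffs11 f)"
  shows "birational f"
proof -
  let ?F = "bil (coeffs11 f)"
  obtain n n' m m' \<alpha> \<beta> \<gamma> where det: "det2 n n' = 1" "det2 m m' = 1"
    and \<alpha>: "\<And>a b. dot \<alpha> (?F a b) = det2 a n' * det2 m b"
    and \<beta>: "\<And>a b. dot \<beta> (?F a b) = det2 n a * det2 b m'"
    and \<gamma>: "\<And>a b. dot \<gamma> (?F a b) = det2 n a * det2 m b"
    and inv: "\<And>c. ?F (\<lambda>p. dot \<alpha> c * n p + dot \<gamma> c * n' p) (\<lambda>q. dot \<beta> c * m q + dot \<gamma> c * m' q) =
       (\<lambda>i. dot \<gamma> c * c i)"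
    by (rule base_point_normal_form[OF assms(2,3)]) (rule that)
  define A where "A p = linform (\<lambda>i. \<alpha> i * n p + \<gamma> i * n' p)" for p
  define B where "B q = linform (\<lambda>i. \<beta> i * m q + \<gamma> i * m' q)" for q
  have A: "mpoly_eval c (A p) = dot \<alpha> c * n p + dot \<gamma> c * n' p" for c p
    by (simp add: A_def mpoly_eval_linform dot_def sum_3 algebra_simps)
  have B: "mpoly_eval c (B q) = dot \<beta> c * m q + dot \<gamma> c * m' q" for c q
    by (simp add: B_def mpoly_eval_linform dot_def sum_3 algebra_simps)
  have nz: "n' \<noteq> (\<lambda>_. 0)" "m' \<noteq> (\<lambda>_. 0)"
    using det by (auto simp: det2_def)
  have A_nz: "\<exists>p. A p \<noteq> 0"
  proof (rule ccontr)
    assume "\<not> ?thesis"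
    \<comment> \<open>At the value of the map at \<open>(n', m')\<close> the functional
      \<open>\<alpha>\<close> is 0 and \<open>\<gamma>\<close> is 1, so the forms \<open>A\<close>
      evaluate to \<open>n'\<close>.\<close>
    then have "n' p = 0" for p
      using A[of "?F n' m'" p] by (simp add: \<alpha> \<gamma> det det2_self mpoly_eval_zero)
    with nz(1) show False
      by blast
  qed
  have B_nz: "\<exists>q. B q \<noteq> 0"
  proof (rule ccontr)
    assume "\<not> ?thesis"
    then have "m' q = 0" for q
      using B[of "?F n' m'" q] by (simp add: \<beta> \<gamma> det det2_self mpoly_eval_zero)
    with nz(2) show False
      by blast
  qed
  \<comment> \<open>The pullback of the line \<open>\<gamma> = 0\<close>. By the normal form its
    value is \<open>det2 n a * det2 m b\<close>, so off its zero locus both scaling factors are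
    nonzero.\<close>
  define s where "s = (\<Sum>i\<in>UNIV. const (\<gamma> i) * f i)"
  have s: "bihomogeneous 1 1 s"
    unfolding s_def by (rule bihomogeneous_combination[OF f])
  have s_eval: "mpoly_eval (case_sum a b) s = dot \<gamma> (?F a b)" for a b
    unfolding mpoly_eval_bihomogeneous_11[of f, OF f, symmetric]
    by (simp add: s_def mpoly_eval_sum mpoly_eval_mult mpoly_eval_const dot_def)
  have "P = (abs_proj n', abs_proj m') \<Longrightarrow> P \<notin> bi_zero_locus {s}" for P
    using abs_proj_mem_bi_zero_locus[of "{s}" n' m'] s nz by (auto simp: s_eval \<gamma> det)
  then have s_ne: "bi_zero_locus {s} \<noteq> UNIV"
    by blast
  have left_inverse: "(P, P) \<in> biproj_map f O proj_bimap A B" if "P \<notin> bi_zero_locus {s}" for P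
  proof -
    obtain a b where ab: "a \<noteq> (\<lambda>_. 0)" "b \<noteq> (\<lambda>_. 0)" "P = (abs_proj a, abs_proj b)"
      by (cases P) (metis abs_proj_cases)
    have "dot \<gamma> (?F a b) \<noteq> 0"
      using that ab abs_proj_mem_bi_zero_locus[of "{s}" a b] s by (auto simp: s_eval)
    then have F: "?F a b \<noteq> (\<lambda>_. 0)" and d: "det2 n a \<noteq> 0" "det2 m b \<noteq> 0"
      by (auto simp: dot_zero) (simp_all add: \<gamma>)
    have Aa: "(\<lambda>p. mpoly_eval (?F a b) (A p)) = (\<lambda>p. det2 m b * a p)"
    proof
      fix p
      have "mpoly_eval (?F a b) (A p) = det2 m b * (det2 a n' * n p + det2 n a * n' p)"
        by (simp add: A \<alpha> \<gamma> algebra_simps)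
      then show "mpoly_eval (?F a b) (A p) = det2 m b * a p"
        by (simp only: det2_expand[OF det(1)])
    qed
    have Bb: "(\<lambda>q. mpoly_eval (?F a b) (B q)) = (\<lambda>q. det2 n a * b q)"
    proof
      fix q
      have "mpoly_eval (?F a b) (B q) = det2 n a * (det2 b m' * m q + det2 m b * m' q)"
        by (simp add: B \<beta> \<gamma> algebra_simps)
      then show "mpoly_eval (?F a b) (B q) = det2 n a * b q"
        by (simp only: det2_expand[OF det(2)])
    qed
    have "(\<lambda>p. det2 m b * a p) \<noteq> (\<lambda>_. 0)" "(\<lambda>q. det2 n a * b q) \<noteq> (\<lambda>_. 0)"
      using ab d by (auto simp: fun_eq_iff)
    then have "(abs_proj (?F a b),
        (abs_proj (\<lambda>p. det2 m b * a p), abs_proj (\<lambda>q. det2 n a * b q))) \<in> proj_bimap A B"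
      unfolding proj_bimap_def Aa[symmetric] Bb[symmetric] using F by blast
    moreover have "(P, abs_proj (?F a b)) \<in> biproj_map f"
      unfolding ab(3) by (rule biproj_mapI[OF f ab(1,2) F])
    ultimately show ?thesis
      unfolding abs_proj_scale[OF ab(1) d(2)] abs_proj_scale[OF ab(2) d(1)] ab(3) by blast
  qed
  have hom: "\<forall>t\<in>{linform \<gamma>}. \<exists>d. homogeneous d t"
    using homogeneous_linform by blast
  have "dot \<gamma> (?F n' m') = 1"
    by (simp add: \<gamma> det)
  then have "?F n' m' \<noteq> (\<lambda>_. 0)" "dot \<gamma> (?F n' m') \<noteq> 0"
    by (auto simp: dot_zero)
  then have "abs_proj (?F n' m') \<notin> zero_locus {linform \<gamma>}"
    using abs_proj_mem_zero_locus[OF hom] by (simp add: mpoly_eval_linform)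
  then have \<gamma>_ne: "zero_locus {linform \<gamma>} \<noteq> UNIV"
    by blast
  have right_inverse: "(Q, Q) \<in> proj_bimap A B O biproj_map f" if "Q \<notin> zero_locus {linform \<gamma>}" for Q
  proof -
    obtain c where c: "c \<noteq> (\<lambda>_. 0)" "Q = abs_proj c"
      by (rule abs_proj_cases)
    have c\<gamma>: "dot \<gamma> c \<noteq> 0"
      using that c abs_proj_mem_zero_locus[OF hom c(1)] by (simp add: mpoly_eval_linform)
    define a where "a p = mpoly_eval c (A p)" for p
    define b where "b q = mpoly_eval c (B q)" for q
    have F: "?F a b = (\<lambda>i. dot \<gamma> c * c i)"
      unfolding a_def b_def A B by (rule inv)
    have F_nz: "?F a b \<noteq> (\<lambda>_. 0)"
      unfolding F using c(1) c\<gamma> by (auto simp: fun_eq_iff)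
    then have ab: "a \<noteq> (\<lambda>_. 0)" "b \<noteq> (\<lambda>_. 0)"
      by (auto simp: bil_def[abs_def])
    then have "(Q, (abs_proj a, abs_proj b)) \<in> proj_bimap A B"
      unfolding proj_bimap_def c(2) a_def b_def using c(1) by blast
    moreover have "((abs_proj a, abs_proj b), abs_proj (?F a b)) \<in> biproj_map f"
      by (rule biproj_mapI[OF f ab F_nz])
    moreover have "abs_proj (?F a b) = Q"
      unfolding F c(2) by (rule abs_proj_scale[OF c(1) c\<gamma>])
    ultimately show ?thesis
      by blast
  qed
  have "\<exists>Z. biproj_closed Z \<and> Z \<noteq> UNIV \<and> (\<forall>P. P \<notin> Z \<longrightarrow> (P, P) \<in> biproj_map f O proj_bimap A B)"
    using biproj_closed_bi_zero_locus[OF s] s_ne left_inverse by blast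
  moreover have "\<exists>Z. proj_closed Z \<and> Z \<noteq> UNIV \<and> (\<forall>Q. Q \<notin> Z \<longrightarrow> (Q, Q) \<in> proj_bimap A B O biproj_map f)"
    using proj_closed_zero_locus[OF homogeneous_linform] \<gamma>_ne right_inverse by blast
  moreover have "\<forall>i. homogeneous 1 (A i)" "\<forall>j. homogeneous 1 (B j)"
    unfolding A_def B_def using homogeneous_linform by blast+
  ultimately show ?thesis
    unfolding birational_def using A_nz B_nz by blast
qed

section \<open>Functions that are polynomial on lines\<close>

text \<open>Only restrictions to lines are recorded, so that composites such as a form evaluated at
  linear functions of \<open>z\<close> need no representation as multivariate polynomials.\<close>

definition poly_on_lines :: "(('v \<Rightarrow> 'k) \<Rightarrow> 'k::field) \<Rightarrow> bool" where
  "poly_on_lines F \<longleftrightarrow> (\<forall>p d. \<exists>q. \<forall>t. F (\<lambda>v. p v + t * d v) = poly q t)"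

lemma poly_on_lines_const: "poly_on_lines (\<lambda>_. c)"
  unfolding poly_on_lines_def by (intro allI exI[of _ "[:c:]"]) simp

lemma poly_on_lines_coordinate: "poly_on_lines (\<lambda>z. z v)"
  unfolding poly_on_lines_def
proof (intro allI)
  fix p d :: "'a \<Rightarrow> 'b"
  show "\<exists>q. \<forall>t. p v + t * d v = poly q t"
    by (intro exI[of _ "[:p v, d v:]"]) simp
qed

lemma poly_on_lines_add:
  assumes "poly_on_lines F" "poly_on_lines G"
  shows "poly_on_lines (\<lambda>z. F z + G z)"
  using assms unfolding poly_on_lines_def by (metis poly_add)

lemma poly_on_lines_mult:
  assumes "poly_on_lines F" "poly_on_lines G"
  shows "poly_on_lines (\<lambda>z. F z * G z)"
  using assms unfolding poly_on_lines_def by (metis poly_mult)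

lemma poly_on_lines_sum:
  assumes "\<And>i. i \<in> I \<Longrightarrow> poly_on_lines (F i)"
  shows "poly_on_lines (\<lambda>z. \<Sum>i\<in>I. F i z)"
  using assms
  by (induction I rule: infinite_finite_induct) (simp_all add: poly_on_lines_const poly_on_lines_add)

lemma poly_on_lines_prod:
  assumes "\<And>i. i \<in> I \<Longrightarrow> poly_on_lines (F i)"
  shows "poly_on_lines (\<lambda>z. \<Prod>i\<in>I. F i z)"
  using assms
  by (induction I rule: infinite_finite_induct) (simp_all add: poly_on_lines_const poly_on_lines_mult)

lemma poly_on_lines_power:
  assumes "poly_on_lines F"
  shows "poly_on_lines (\<lambda>z. F z ^ n)"
  by (induction n) (simp_all add: poly_on_lines_const poly_on_lines_mult assms)

lemma poly_on_lines_mpoly_eval: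
  assumes "\<And>v. poly_on_lines (\<lambda>z. L z v)"
  shows "poly_on_lines (\<lambda>z. mpoly_eval (L z) h)"
  unfolding mpoly_eval_def
  by (intro poly_on_lines_sum poly_on_lines_mult poly_on_lines_const poly_on_lines_prod
      poly_on_lines_power assms)

text \<open>On the line through \<open>x\<close> and \<open>y\<close> both functions become nonzero
  polynomials, as the parameters 0 and 1 show. Their product has finitely many roots, so an infinite
  field contains a parameter avoiding all of them.\<close>

lemma poly_on_lines_common_nonzero:
  fixes F G :: "('v \<Rightarrow> 'k::field) \<Rightarrow> 'k"
  assumes "infinite (UNIV :: 'k set)" "poly_on_lines F" "poly_on_lines G" "F x \<noteq> 0" "G y \<noteq> 0"
  obtains z where "F z \<noteq> 0" "G z \<noteq> 0"
proof -
  obtain q where q: "\<And>t. F (\<lambda>v. x v + t * (y v - x v)) = poly q t"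
    using assms(2) unfolding poly_on_lines_def by metis
  obtain r where r: "\<And>t. G (\<lambda>v. x v + t * (y v - x v)) = poly r t"
    using assms(3) unfolding poly_on_lines_def by metis
  have "q \<noteq> 0" "r \<noteq> 0"
    using q[of 0] r[of 1] assms(4,5) by auto
  then have "finite {t. poly (q * r) t = 0}"
    by (intro poly_roots_finite) simp
  then obtain t where "poly (q * r) t \<noteq> 0"
    using ex_new_if_finite[OF assms(1)] by blast
  then show ?thesis
    using that q r by (metis mult_eq_0_iff poly_mult)
qed

text \<open>
  Without a base point the map is invariant under the involution exchanging \<open>(a, \<psi> a')\<close> and
  \<open>(a', \<psi> a)\<close>, where \<open>\<psi>\<close> is the linear isomorphism with columns \<open>m\<close> and \<open>m'\<close>; hence it is not
  injective on any nonempty open set.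
\<close>

lemma birational_imp_base_point:
  fixes f :: "3 \<Rightarrow> (2 + 2, 'k::field) mpoly"
  assumes "infinite (UNIV :: 'k set)" and f: "\<And>i. bihomogeneous 1 1 (f i)" and "birational f"
  shows "has_base_point (coeffs11 f)"
proof (cases rule: base_point_or_symmetric[of "coeffs11 f"])
  case (2 m m')
  define \<psi> where "\<psi> a = (\<lambda>q. a 0 * m q + a 1 * m' q)" for a :: "2 \<Rightarrow> 'k"
  have sym: "bil (coeffs11 f) a (\<psi> b) = bil (coeffs11 f) b (\<psi> a)" for a b
    unfolding \<psi>_def by (rule 2(2))
  have \<psi>_nz: "\<psi> a \<noteq> (\<lambda>_. 0)" if "a \<noteq> (\<lambda>_. 0)" for a
  proof
    assume "\<psi> a = (\<lambda>_. 0)"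
    then have "det2 (\<psi> a) m' = 0" "det2 m (\<psi> a) = 0"
      by (simp_all add: det2_def)
    moreover have "det2 (\<psi> a) m' = a 0 * det2 m m'" "det2 m (\<psi> a) = a 1 * det2 m m'"
      by (simp_all add: det2_def \<psi>_def algebra_simps)
    ultimately have "a 0 = 0" "a 1 = 0"
      using 2(1) by simp_all
    with that show False
      by (simp add: fun_eq_iff all_bit)
  qed
  have \<psi>_surj: "\<exists>a. \<psi> a = b" for b
  proof
    let ?d = "det2 m m'"
    show "\<psi> (\<lambda>p. (if p = 0 then det2 b m' else det2 m b) / ?d) = b"
    proof
      fix q
      have "det2 b m' * m q + det2 m b * m' q = ?d * b q"
        using bit_cases[of q] by (auto simp: det2_def algebra_simps)
      then show "\<psi> (\<lambda>p. (if p = 0 then det2 b m' else det2 m b) / ?d) q = b q"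
        using 2(1) by (simp add: \<psi>_def field_simps)
    qed
  qed
  obtain A B d e Z where A: "\<And>i. homogeneous d (A i)" and B: "\<And>j. homogeneous e (B j)"
    and Z: "biproj_closed Z" "Z \<noteq> UNIV" "\<And>P. P \<notin> Z \<Longrightarrow> (P, P) \<in> biproj_map f O proj_bimap A B"
    using assms(3) unfolding birational_def by blast
  obtain S where S: "\<forall>s\<in>S. \<exists>p q. bihomogeneous p q s" "Z = bi_zero_locus S"
    using Z(1) unfolding biproj_closed_def bi_zero_locus_def by blast
  obtain P where "P \<notin> Z"
    using Z(2) by blast
  moreover obtain a0 b0 where ab0: "a0 \<noteq> (\<lambda>_. 0)" "b0 \<noteq> (\<lambda>_. 0)" "P = (abs_proj a0, abs_proj b0)"
    by (cases P) (metis abs_proj_cases)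
  ultimately obtain s where s: "s \<in> S" "mpoly_eval (case_sum a0 b0) s \<noteq> 0"
    using abs_proj_mem_bi_zero_locus[OF S(1) ab0(1,2)] S(2) by blast
  obtain b1 where b1: "\<psi> b1 = b0"
    using \<psi>_surj by blast
  \<comment> \<open>A vector \<open>z\<close> with four entries encodes a pair
    \<open>(a, a')\<close>. \<open>F1\<close> and \<open>F2\<close> test that
    \<open>(a, \<psi> a')\<close> and its image under the involution avoid \<open>Z\<close>;
    \<open>F3\<close> tests that \<open>a\<close> and \<open>a'\<close> are distinct points.\<close>
  define l where "l z = (\<lambda>p. z (Inl p))" for z :: "2 + 2 \<Rightarrow> 'k"
  define r where "r z = (\<lambda>q. z (Inr q))" for z :: "2 + 2 \<Rightarrow> 'k"
  define F1 where "F1 z = mpoly_eval (case_sum (l z) (\<psi> (r z))) s" for z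
  define F2 where "F2 z = mpoly_eval (case_sum (r z) (\<psi> (l z))) s" for z
  define F3 where "F3 z = det2 (l z) (r z)" for z
  have lines: "poly_on_lines (\<lambda>z. l z p)" "poly_on_lines (\<lambda>z. r z p)"
    "poly_on_lines (\<lambda>z. \<psi> (l z) p)" "poly_on_lines (\<lambda>z. \<psi> (r z) p)" for p
    unfolding l_def r_def \<psi>_def
    by (intro poly_on_lines_add poly_on_lines_mult poly_on_lines_const poly_on_lines_coordinate)+
  have F1: "poly_on_lines F1"
    unfolding F1_def
  proof (rule poly_on_lines_mpoly_eval)
    show "poly_on_lines (\<lambda>z. case_sum (l z) (\<psi> (r z)) v)" for v
      by (cases v) (simp_all add: lines)
  qed
  have F2: "poly_on_lines F2"
    unfolding F2_def
  proof (rule poly_on_lines_mpoly_eval)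
    show "poly_on_lines (\<lambda>z. case_sum (r z) (\<psi> (l z)) v)" for v
      by (cases v) (simp_all add: lines)
  qed
  have "poly_on_lines (\<lambda>z. l z 0 * r z 1 + (- 1) * (l z 1 * r z 0))"
    by (intro poly_on_lines_add poly_on_lines_mult poly_on_lines_const lines)
  then have F3: "poly_on_lines F3"
    by (simp add: F3_def[abs_def] det2_def)
  have lr: "l (case_sum a b) = a" "r (case_sum a b) = b" for a b
    by (simp_all add: l_def r_def)
  \<comment> \<open>Since \<open>\<psi> b1 = b0\<close>, both conditions are tested at the known
    point outside \<open>Z\<close>, the second with the two arguments exchanged.\<close>
  have "F1 (case_sum a0 b1) \<noteq> 0" "F2 (case_sum b1 a0) \<noteq> 0"
    using s(2) by (simp_all add: F1_def F2_def lr b1)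
  then obtain z where "F1 z \<noteq> 0" "F2 z \<noteq> 0"
    using poly_on_lines_common_nonzero[OF assms(1) F1 F2] by blast
  then have "F1 z * F2 z \<noteq> 0"
    by simp
  moreover have "F3 (case_sum (\<lambda>p. of_bool (p = 0)) (\<lambda>p. of_bool (p = 1))) \<noteq> 0"
    by (simp add: F3_def lr det2_def)
  ultimately obtain w where w: "F1 w * F2 w \<noteq> 0" "F3 w \<noteq> 0"
    by (rule poly_on_lines_common_nonzero[OF assms(1) poly_on_lines_mult[OF F1 F2] F3])
  define a where "a = l w"
  define a' where "a' = r w"
  have det: "det2 a a' \<noteq> 0"
    using w(2) by (simp add: F3_def a_def a'_def)
  then have nz: "a \<noteq> (\<lambda>_. 0)" "a' \<noteq> (\<lambda>_. 0)"
    by (auto simp: det2_def)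
  have "mpoly_eval (case_sum a (\<psi> a')) s \<noteq> 0" "mpoly_eval (case_sum a' (\<psi> a)) s \<noteq> 0"
    using w(1) by (simp_all add: F1_def F2_def a_def a'_def)
  then have "(abs_proj a, abs_proj (\<psi> a')) \<notin> Z" "(abs_proj a', abs_proj (\<psi> a)) \<notin> Z"
    using abs_proj_mem_bi_zero_locus[OF S(1)] nz \<psi>_nz s(1) S(2) by blast+
  then obtain Q Q' where
    Q: "((abs_proj a, abs_proj (\<psi> a')), Q) \<in> biproj_map f"
      "(Q, (abs_proj a, abs_proj (\<psi> a'))) \<in> proj_bimap A B" and
    Q': "((abs_proj a', abs_proj (\<psi> a)), Q') \<in> biproj_map f"
      "(Q', (abs_proj a', abs_proj (\<psi> a))) \<in> proj_bimap A B"
    using Z(3) by blast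
  \<comment> \<open>The symmetry gives the two points the same image, and the inverse, being
    single-valued, must return both of them from it. Their first components then agree, contrary to
    \<open>det\<close>.\<close>
  have "Q = Q'"
    using biproj_map_value[OF f nz(1) \<psi>_nz[OF nz(2)] Q(1)]
      biproj_map_value[OF f nz(2) \<psi>_nz[OF nz(1)] Q'(1)] sym[of a a'] by simp
  then have "abs_proj a = abs_proj a'"
    using proj_bimap_single_valued[OF A B Q(2)] Q'(2) by blast
  then obtain c where "a' = (\<lambda>i. c * a i)"
    using abs_proj_eqD[OF nz] by blast
  then have "det2 a a' = 0"
    by (simp add: det2_def)
  with det show ?thesis
    by simp
qed

theorem proposition7:
  fixes f :: "3 \<Rightarrow> (2 + 2, 'k::field) mpoly"
  assumes "infinite (UNIV :: 'k set)"
    and "\<And>i. bihomogeneous 1 1 (f i)"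
    and "no_common_factor f"
    and "dominant f"
  shows "(birational f \<longleftrightarrow> (\<exists>g. syzygy 1 0 f g \<and> g \<noteq> (\<lambda>_. 0))) \<and>
         ((\<exists>g. syzygy 1 0 f g \<and> g \<noteq> (\<lambda>_. 0)) \<longleftrightarrow> (\<exists>g. syzygy 0 1 f g \<and> g \<noteq> (\<lambda>_. 0)))"
proof -
  let ?M = "coeffs11 f"
  have nondeg: "nondegenerate ?M"
    using assms(2,4) by (rule dominant_imp_nondegenerate)
  have "birational f \<longleftrightarrow> has_base_point ?M"
    using birational_imp_base_point[OF assms(1), of f, OF assms(2)]
      base_point_imp_birational[of f, OF assms(2) nondeg]
    by blast
  moreover have "(\<exists>g. syzygy 1 0 f g \<and> g \<noteq> (\<lambda>_. 0)) \<longleftrightarrow> has_base_point ?M"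
    unfolding syzygy_10_iff[of f, OF assms(2)] by (rule linear_syzygy_iff_base_point[OF nondeg])
  moreover have "(\<exists>g. syzygy 0 1 f g \<and> g \<noteq> (\<lambda>_. 0)) \<longleftrightarrow> has_base_point ?M"
    unfolding syzygy_01_iff[of f, OF assms(2)]
    using linear_syzygy_iff_base_point[of "\<lambda>i p q. ?M i q p"] nondeg
    by (simp add: nondegenerate_swap[of ?M] has_base_point_swap[of ?M])
  ultimately show ?thesis
    by blast
qed

end
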